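(* Let $T>0$, $\Delta_T=\{(s,t):0\le s<t\le T\}$, and let $V^{1,1},V^{1,2},V^2$ be finite-dimensional Banach spaces. Let $A:\Delta_T\times\Omega\to(V^{1,1}\otimes V^{1,2})\otimes V^2$ and $A^1:\Delta_T\times\Omega\to V^{1,1}\otimes V^{1,2}$ be càdlàg two-parameter processes and $A^2:[0,T]\times\Omega\to V^2$, $A^{1,i}:[0,T]\times\Omega\to V^{1,i}$ ($i=1,2$) càdlàg processes such that for all $s<u<t$ in $[0,T]$ $$\delta A_{s,u,t}=A^1_{s,u}\otimes\delta A^2_{u,t},\qquad\delta A^1_{s,u,t}=\delta A^{1,1}_{s,u}\otimes\delta A^{1,2}_{u,t}.$$ Assume there are $q\ge3$ and $\beta>1/q$ such that, with implicit constants uniform over $(s,t)\in\Delta_T$, $$\|\delta A^{1,1}_{s,t}\|_{L^q}\vee\|\delta A^{1,2}_{s,t}\|_{L^q}\vee\|\delta A^2_{s,t}\|_{L^q}\lesssim|t-s|^\beta,\qquad\|A^1_{s,t}\|_{L^{q/2}}\lesssim|t-s|^{2\beta},\qquad\|A_{s,t}\|_{L^{q/3}}\lesssim|t-s|^{3\beta}.$$ Then for every $\alpha\in[0,\beta-1/q)$ there are modifications $(\tilde A,\tilde A^1,\tilde A^{1,1},\tilde A^{1,2},\tilde A^2)$ of $(A,A^1,A^{1,1},A^{1,2},A^2)$ and random variables $\tilde K^{(l)}_\alpha\in L^{q/l}$, $l=1,2,3$, such that almost surely, for all $(s,t)\in\Delta_T$, $$|\tilde A_{s,t}|\le\tilde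 K^{(3)}_\alpha|t-s|^{3\alpha},\qquad|\tilde A^1_{s,t}|\le\tilde K^{(2)}_\alpha|t-s|^{2\alpha},\qquad|\delta\tilde A^2_{s,t}|\vee\max_{j=1,2}|\delta\tilde A^{1,j}_{s,t}|\le\tilde K^{(1)}_\alpha|t-s|^\alpha.$$
   Context: For a path $X$, $\delta X_{s,t}=X_t-X_s$; for a two-parameter function $A$ on $\Delta_T$, $\delta A_{s,u,t}=A_{s,t}-A_{s,u}-A_{u,t}$. $(\Omega,\mathfrak F,\mathbb P)$ is a probability space and $L^q=L^q(\Omega,\mathbb P)$. *)

theory Defs
  imports "HOL-Probability.Probability"
begin

definition finite_dim :: "'a::real_vector set \<Rightarrow> bool" where
  "finite_dim V \<longleftrightarrow> (\<exists>B. finite B \<and> V \<subseteq> span B)"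

text \<open>
  A tensor product of two real vector spaces is a type \<open>'c\<close> together with a bilinear map
  \<open>tens\<close> into it having the universal property. Over a field it suffices to test the
  universal property on scalar-valued bilinear forms; the lemma \<open>tensor_product_universal\<close>
  below recovers it for an arbitrary target space. No norm enters the definition: in finite
  dimensions all norms on \<open>'c\<close> are equivalent.
\<close>

definition tensor_product :: "('a::real_vector \<Rightarrow> 'b::real_vector \<Rightarrow> 'c::real_vector) \<Rightarrow> bool" where
  "tensor_product tens \<longleftrightarrow>
     bilinear tens \<and>
     (\<forall>\<phi> :: 'a \<Rightarrow> 'b \<Rightarrow> real. bilinear \<phi> \<longrightarrow>
        (\<exists>!L. linear L \<and> (\<forall>x y. L (tens x y) = \<phi> x y)))"

lemma linear_functional_separates:
  fixes z :: "'a::real_vector"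
  assumes "z \<notin> span S"
  obtains l :: "'a \<Rightarrow> real" where "linear l" "\<And>x. x \<in> S \<Longrightarrow> l x = 0" "l z = 1"
proof -
  obtain B where B: "B \<subseteq> S" "independent B" "S \<subseteq> span B"
    by (metis maximal_independent_subset)
  have "span B \<subseteq> span S"
    using B(1) by (rule span_mono)
  then have z: "z \<notin> span B"
    using assms by blast
  then have "independent (insert z B)"
    using B(2) by (simp add: independent_insert)
  then obtain l :: "'a \<Rightarrow> real" where l: "linear l" "\<forall>x\<in>insert z B. l x = (if x = z then 1 else 0)"
    using linear_independent_extend[where f = "\<lambda>x. if x = z then 1 else 0"] by metis
  have "z \<notin> B"
    using z span_base by blast
  then have "\<And>x. x \<in> B \<Longrightarrow> l x = 0"
    using l(2) by auto
  then have l_S: "\<And>x. x \<in> S \<Longrightarrow> l x = 0"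
    using linear_eq_0_on_span[OF l(1)] B(3) by blast
  show thesis
    by (rule that[OF l(1) l_S]) (use l(2) in auto)
qed

lemma tensor_product_universal:
  fixes tens :: "'a::real_vector \<Rightarrow> 'b::real_vector \<Rightarrow> 'c::real_vector"
    and \<phi> :: "'a \<Rightarrow> 'b \<Rightarrow> 'e::real_vector"
  assumes tens: "tensor_product tens" and \<phi>: "bilinear \<phi>"
  shows "\<exists>!L. linear L \<and> (\<forall>x y. L (tens x y) = \<phi> x y)"
proof -
  define S where "S = {tens x y | x y. True}"
  have tens_S: "tens x y \<in> S" for x y
    by (auto simp: S_def)
  have uni: "\<exists>!L. linear L \<and> (\<forall>x y. L (tens x y) = \<psi> x y)"
    if "bilinear \<psi>" for \<psi> :: "'a \<Rightarrow> 'b \<Rightarrow> real"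
    using tens that by (auto simp: tensor_product_def)
  have "bilinear (\<lambda>(x::'a) (y::'b). 0::real)"
    by (simp add: bilinear_def linear_iff)
  from uni[OF this] have zero: "l = (\<lambda>_. 0)"
    if "linear l" "\<And>x y. l (tens x y) = 0" for l :: "'c \<Rightarrow> real"
    using that linear_zero by blast
  have span_S: "span S = UNIV"
  proof (rule ccontr)
    assume "span S \<noteq> UNIV"
    then obtain z where "z \<notin> span S" by blast
    then obtain l :: "'c \<Rightarrow> real" where l: "linear l" "\<And>x. x \<in> S \<Longrightarrow> l x = 0" "l z = 1"
      using linear_functional_separates[of z S] by metis
    have "l = (\<lambda>_. 0)"
      by (rule zero[OF l(1)]) (rule l(2)[OF tens_S])
    with l(3) show False by simp
  qed
  obtain B where B: "B \<subseteq> S" "independent B" "S \<subseteq> span B"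
    by (metis maximal_independent_subset)
  have span_B: "span B = UNIV"
    using B(3) span_S by (metis span_mono span_span top.extremum_unique)
  have "\<forall>b\<in>B. \<exists>p. tens (fst p) (snd p) = b"
    using B(1) by (fastforce simp: S_def)
  then obtain p where p: "\<And>b. b \<in> B \<Longrightarrow> tens (fst (p b)) (snd (p b)) = b"
    by metis
  obtain L where L: "linear L" "\<forall>b\<in>B. L b = \<phi> (fst (p b)) (snd (p b))"
    using linear_independent_extend[OF B(2), where f = "\<lambda>b. \<phi> (fst (p b)) (snd (p b))"] by metis
  have L_tens: "L (tens x y) = \<phi> x y" for x y
  proof (rule ccontr)
    assume "L (tens x y) \<noteq> \<phi> x y"
    then have "L (tens x y) - \<phi> x y \<notin> span {}"
      by simp
    then obtain l :: "'e \<Rightarrow> real" where l: "linear l" "l (L (tens x y) - \<phi> x y) = 1"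
      using linear_functional_separates[of "L (tens x y) - \<phi> x y" "{}"] by metis
    have "bilinear (\<lambda>x y. l (\<phi> x y))"
      using \<phi> l(1) by (simp add: bilinear_def linear_iff)
    from uni[OF this] obtain M where M: "linear M" "\<And>x y. M (tens x y) = l (\<phi> x y)"
      by blast
    have "(l \<circ> L) z = M z" for z
    proof (rule linear_eq_on[of "l \<circ> L" M z B])
      show "linear (l \<circ> L)"
        using L(1) l(1) by (rule linear_compose)
      show "(l \<circ> L) b = M b" if "b \<in> B" for b
        using L(2) M(2) p[OF that] that by (metis comp_apply)
    qed (use M(1) span_B in auto)
    then have "l (L (tens x y)) = l (\<phi> x y)"
      using M(2) by (metis comp_apply)
    then show False
      using l by (simp add: linear_diff)
  qed
  have "M = L" if M: "linear M" "\<forall>x y. M (tens x y) = \<phi> x y" for M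
  proof
    fix z
    show "M z = L z"
      by (rule linear_eq_on[of M L z S])
         (use M L(1) L_tens span_S in \<open>auto simp: S_def\<close>)
  qed
  then show ?thesis
    using L(1) L_tens by blast
qed

lemma tensor_product_vec:
  "tensor_product (\<lambda>(x::real^'m) (y::real^'n). (\<chi> i j. x $ i * y $ j) :: real^'n^'m)"
  unfolding tensor_product_def
proof (intro conjI allI impI)
  let ?t = "\<lambda>(x::real^'m) (y::real^'n). (\<chi> i j. x $ i * y $ j) :: real^'n^'m"
  show bil: "bilinear ?t"
    by (simp add: bilinear_def linear_iff vec_eq_iff algebra_simps)
  have decomp: "z = (\<Sum>i\<in>UNIV. \<Sum>j\<in>UNIV. (z $ i $ j) *\<^sub>R ?t (axis i 1) (axis j 1))"
    for z :: "real^'n^'m"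
    by (simp add: vec_eq_iff axis_def if_distrib[where f="\<lambda>x. x * _"] if_distrib[where f="\<lambda>x. _ * x"]
          cong: if_cong)
  fix \<phi> :: "real^'m \<Rightarrow> real^'n \<Rightarrow> real"
  assume \<phi>: "bilinear \<phi>"
  define L where "L = (\<lambda>z::real^'n^'m. \<Sum>i\<in>UNIV. \<Sum>j\<in>UNIV. (z $ i $ j) * \<phi> (axis i 1) (axis j 1))"
  have lin: "linear L"
    by (simp add: L_def linear_iff algebra_simps sum.distrib sum_distrib_left)
  have L_t: "L (?t x y) = \<phi> x y" for x y
  proof -
    have "\<phi> x y = \<phi> (\<Sum>i\<in>UNIV. (x $ i) *\<^sub>R axis i 1) (\<Sum>j\<in>UNIV. (y $ j) *\<^sub>R axis j 1)"
      by (simp add: basis_expansion flip: scalar_mult_eq_scaleR)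
    also have "\<dots> = (\<Sum>(i, j)\<in>UNIV \<times> UNIV. \<phi> ((x $ i) *\<^sub>R axis i 1) ((y $ j) *\<^sub>R axis j 1))"
      by (rule bilinear_sum[OF \<phi>])
    also have "\<dots> = L (?t x y)"
      by (simp only: L_def sum.cartesian_product[symmetric])
         (simp add: bilinear_lmul[OF \<phi>] bilinear_rmul[OF \<phi>] ac_simps)
    finally show ?thesis by simp
  qed
  show "\<exists>!L. linear L \<and> (\<forall>x y. L (?t x y) = \<phi> x y)"
  proof (rule ex1I[of _ L])
    show "linear L \<and> (\<forall>x y. L (?t x y) = \<phi> x y)"
      using lin L_t by blast
    fix M assume M: "linear M \<and> (\<forall>x y. M (?t x y) = \<phi> x y)"
    show "M = L"
    proof
      fix z
      have "M z = (\<Sum>i\<in>UNIV. \<Sum>j\<in>UNIV. (z $ i $ j) *\<^sub>R M (?t (axis i 1) (axis j 1)))"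
        using M by (subst decomp) (simp only: linear_sum linear_scale)
      also have "\<dots> = L z"
        using M by (simp add: L_def)
      finally show "M z = L z" .
    qed
  qed
qed

definition time_simplex :: "real \<Rightarrow> (real \<times> real) set" where
  "time_simplex T = {(s, t). 0 \<le> s \<and> s < t \<and> t \<le> T}"

definition incr :: "(real \<Rightarrow> '\<omega> \<Rightarrow> 'a) \<Rightarrow> real \<Rightarrow> real \<Rightarrow> '\<omega> \<Rightarrow> 'a::ab_group_add" where
  "incr X s t \<omega> = X t \<omega> - X s \<omega>"

definition incr2 ::
  "(real \<Rightarrow> real \<Rightarrow> '\<omega> \<Rightarrow> 'a) \<Rightarrow> real \<Rightarrow> real \<Rightarrow> real \<Rightarrow> '\<omega> \<Rightarrow> 'a::ab_group_add" where
  "incr2 A s u t \<omega> = A s t \<omega> - A s u \<omega> - A u t \<omega>"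

text \<open>
  At an endpoint of \<open>I\<close> that cannot be approached from the relevant side within \<open>I\<close>, the
  corresponding filter is trivial and nothing is required.
\<close>

definition cadlag_on :: "real set \<Rightarrow> (real \<Rightarrow> 'a::topological_space) \<Rightarrow> bool" where
  "cadlag_on I f \<longleftrightarrow>
     (\<forall>t\<in>I. (f \<longlongrightarrow> f t) (at t within I \<inter> {t<..}) \<and>
            (\<exists>l. (f \<longlongrightarrow> l) (at t within I \<inter> {..<t})))"

definition cadlag_process ::
  "'\<omega> measure \<Rightarrow> real \<Rightarrow> (real \<Rightarrow> '\<omega> \<Rightarrow> 'a::topological_space) \<Rightarrow> bool" where
  "cadlag_process M T X \<longleftrightarrow>
     (\<forall>t\<in>{0..T}. X t \<in> borel_measurable M) \<and>
     (AE \<omega> in M. cadlag_on {0..T} (\<lambda>t. X t \<omega>))"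

text \<open>A two-parameter function is cadlag if it is so in each variable, the other one being fixed.\<close>

definition cadlag_process2 ::
  "'\<omega> measure \<Rightarrow> real \<Rightarrow> (real \<Rightarrow> real \<Rightarrow> '\<omega> \<Rightarrow> 'a::topological_space) \<Rightarrow> bool" where
  "cadlag_process2 M T A \<longleftrightarrow>
     (\<forall>(s, t)\<in>time_simplex T. A s t \<in> borel_measurable M) \<and>
     (AE \<omega> in M.
        (\<forall>s\<in>{0..<T}. cadlag_on {s<..T} (\<lambda>t. A s t \<omega>)) \<and>
        (\<forall>t\<in>{0<..T}. cadlag_on {0..<t} (\<lambda>s. A s t \<omega>)))"

definition modification ::
  "'\<omega> measure \<Rightarrow> 'i set \<Rightarrow> ('i \<Rightarrow> '\<omega> \<Rightarrow> 'a::topological_space) \<Rightarrow> ('i \<Rightarrow> '\<omega> \<Rightarrow> 'a) \<Rightarrow> bool" where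
  "modification M I X X' \<longleftrightarrow>
     (\<forall>i\<in>I. X' i \<in> borel_measurable M \<and> (AE \<omega> in M. X' i \<omega> = X i \<omega>))"

definition Lq_space :: "'\<omega> measure \<Rightarrow> real \<Rightarrow> ('\<omega> \<Rightarrow> 'a::real_normed_vector) set" where
  "Lq_space M q = {X \<in> borel_measurable M. integrable M (\<lambda>\<omega>. norm (X \<omega>) powr q)}"

text \<open>This is the \<open>L\<^sup>q\<close> norm for elements of \<open>Lq_space M q\<close> only: the integral below is \<open>0\<close>
  when the integrand is not integrable.\<close>

definition Lq_norm :: "'\<omega> measure \<Rightarrow> real \<Rightarrow> ('\<omega> \<Rightarrow> 'a::real_normed_vector) \<Rightarrow> real" where
  "Lq_norm M q X = (LINT \<omega>|M. norm (X \<omega>) powr q) powr (1 / q)"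

end

theory Submission
  imports Defs
begin

text \<open>
  On the grid of the points \<open>k T / 2^n\<close>, with mesh \<open>h\<close>, weight the \<open>q / l\<close>-th power of the norm of
  each level-\<open>l\<close> increment over a cell by \<open>h powr - (q * \<gamma>)\<close>, where \<open>\<alpha> < \<gamma> < \<beta> - 1 / q\<close>. The weighted
  expectations sum to a finite value because \<open>(\<beta> - \<gamma>) * q > 1\<close>, and the weight is the same for
  \<open>l = 1, 2, 3\<close>. So there is a single \<open>H \<ge> 0\<close> in \<open>L\<^sup>1\<close> such that \<open>R = H powr (1 / q)\<close> bounds all
  level-\<open>l\<close> increments over cells by \<open>R ^ l * h powr (l * \<gamma>)\<close>; no Minkowski inequality is needed, and
  \<open>K\<^sub>l\<close> can be taken to be a multiple of \<open>R ^ l\<close>. Chaining along dyadic points extends these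
  bounds to all dyadic pairs, level by level: Chen's relation controls the additivity defect at one
  level by the bounds of the lower ones. Right-continuity, first in \<open>t\<close> and then in \<open>s\<close>, extends the
  bounds to all pairs, so the given processes are themselves the required modifications.
\<close>

subsection \<open>Chaining on the dyadic grid\<close>

definition dyadic_level :: "real \<Rightarrow> nat \<Rightarrow> real set" where
  "dyadic_level T n = (\<lambda>k. real k * (T / 2 ^ n)) ` {..2 ^ n}"

definition dyadic :: "real \<Rightarrow> real set" where
  "dyadic T = (\<Union>n. dyadic_level T n)"

lemma dyadic_grid_point: "k \<le> 2 ^ n \<Longrightarrow> real k * (T / 2 ^ n) \<in> dyadic T"
  by (auto simp: dyadic_def dyadic_level_def)

lemma dyadic_level_subset: "dyadic_level T n \<subseteq> dyadic T"
  by (auto simp: dyadic_def)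

lemma dyadic_level_mono:
  assumes "m \<le> n"
  shows "dyadic_level T m \<subseteq> dyadic_level T n"
proof
  fix x assume "x \<in> dyadic_level T m"
  then obtain k where k: "k \<le> 2 ^ m" "x = real k * (T / 2 ^ m)"
    by (auto simp: dyadic_level_def)
  have n: "(2::nat) ^ n = 2 ^ m * 2 ^ (n - m)" "(2::real) ^ n = 2 ^ m * 2 ^ (n - m)"
    using assms by (simp_all flip: power_add)
  have "x = real (k * 2 ^ (n - m)) * (T / 2 ^ n)"
    by (simp add: k(2) n(2))
  moreover have "k * 2 ^ (n - m) \<le> 2 ^ n"
    using k(1) by (simp add: n(1))
  ultimately show "x \<in> dyadic_level T n"
    unfolding dyadic_level_def by blast
qed

lemma countable_dyadic: "countable (dyadic T)"
  by (simp add: dyadic_def dyadic_level_def)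

lemma dyadic_bounds:
  assumes "T > 0" "x \<in> dyadic T"
  shows "0 \<le> x" "x \<le> T"
proof -
  obtain k n where k: "k \<le> 2 ^ n" "x = real k * (T / 2 ^ n)"
    using assms by (auto simp: dyadic_def dyadic_level_def)
  have "real k \<le> 2 ^ n"
    using k(1) by (metis of_nat_le_iff of_nat_numeral of_nat_power)
  then show "0 \<le> x" "x \<le> T"
    using assms(1) by (auto simp: k(2) field_simps)
qed

lemma dyadic_reflect:
  assumes "x \<in> dyadic T"
  shows "T - x \<in> dyadic T"
proof -
  obtain k n where k: "k \<le> 2 ^ n" "x = real k * (T / 2 ^ n)"
    using assms by (auto simp: dyadic_def dyadic_level_def)
  then have "T - x = real (2 ^ n - k) * (T / 2 ^ n)"
    by (simp add: of_nat_diff field_simps)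
  then show ?thesis
    using dyadic_grid_point[of "2 ^ n - k" n T] by simp
qed

lemma T_in_dyadic: "T \<in> dyadic T"
  using dyadic_grid_point[of 1 0 T] by simp

lemma dyadic_dense:
  assumes "T > 0" "0 \<le> a" "a < b" "b \<le> T"
  obtains d where "d \<in> dyadic T" "a < d" "d < b"
proof -
  obtain n where n: "T / (b - a) < 2 ^ n"
    using real_arch_pow[of 2 "T / (b - a)"] by auto
  define h where "h = T / 2 ^ n"
  have h: "h > 0" "h < b - a"
    using n assms by (auto simp: h_def field_simps)
  \<comment> \<open>The first grid index strictly to the right of \<open>a\<close>; since
    \<open>h < b - a\<close>, its grid point still lies before \<open>b\<close>.\<close>
  define k where "k = nat \<lfloor>a / h\<rfloor> + 1"
  have "0 \<le> a / h"
    using assms h by simp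
  then have "a / h < real k" "real k \<le> a / h + 1"
    by (auto simp: k_def) linarith+
  then have d: "a < real k * h" "real k * h < b"
    using h by (auto simp: field_simps)
  then have "real k * h < 2 ^ n * h"
    using assms by (simp add: h_def)
  then have "real k < real (2 ^ n)"
    using h by simp
  then have "k \<le> 2 ^ n"
    by linarith
  then show thesis
    using that[of "real k * h"] d dyadic_grid_point[of k n T] by (simp add: h_def)
qed

text \<open>\<open>F\<close> stands for the increment of a path, where \<open>Q = 0\<close>, or for
  a two-parameter function of level 2 or 3, with two or three times the basic exponent. Unlike in a
  sewing lemma, bounds on the cells of every scale are given, which is why any
  \<open>\<gamma> > 0\<close> suffices for summing over scales.\<close>

locale dyadic_chain =
  fixes T \<gamma> P Q :: real and F :: "real \<Rightarrow> real \<Rightarrow> 'a::real_normed_vector"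
  assumes T: "T > 0" and \<gamma>: "\<gamma> > 0" and P: "P \<ge> 0" and Q: "Q \<ge> 0"
    and elem: "\<And>n k. k < 2 ^ n \<Longrightarrow>
      norm (F (real k * (T / 2 ^ n)) (real (Suc k) * (T / 2 ^ n))) \<le> P * (T / 2 ^ n) powr \<gamma>"
    and defect: "\<And>s u t. s \<in> dyadic T \<Longrightarrow> u \<in> dyadic T \<Longrightarrow> t \<in> dyadic T \<Longrightarrow> s < u \<Longrightarrow> u < t \<Longrightarrow>
      norm (F s t - F s u - F u t) \<le> Q * (t - s) powr \<gamma>"
begin

text \<open>One halving costs at most \<open>P + Q\<close> and leaves a cell whose factor
  \<open>h powr \<gamma>\<close> has shrunk by \<open>2 powr - \<gamma>\<close>. \<open>B\<close> is
  the fixed point of \<open>x = P + Q + 2 powr - \<gamma> * x\<close>, so the bound reproduces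
  itself at every scale, whatever the depth.\<close>

definition B :: real where "B = (P + Q) / (1 - 2 powr - \<gamma>)"

lemma geometric_ratio: "0 < 1 - 2 powr - \<gamma>" "1 - 2 powr - \<gamma> \<le> 1"
proof -
  have "2 powr - \<gamma> < 2 powr (0::real)"
    using \<gamma> by (intro powr_less_mono) auto
  then show "0 < 1 - 2 powr - \<gamma>" "1 - 2 powr - \<gamma> \<le> 1" by auto
qed

lemma B_fixpoint: "P + Q + 2 powr - \<gamma> * B = B"
proof -
  have "(1 - 2 powr - \<gamma>) * B = P + Q"
    using geometric_ratio(1) nonzero_eq_divide_eq[of "1 - 2 powr - \<gamma>" B "P + Q"]
    by (metis B_def less_irrefl mult.commute)
  then show ?thesis by (simp add: algebra_simps)
qed

lemma P_le_B: "P \<le> B"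
proof -
  have "P \<le> P + Q" using Q by simp
  also have "\<dots> \<le> B"
    unfolding B_def using geometric_ratio P Q by (simp add: pos_le_divide_eq mult_left_le)
  finally show ?thesis .
qed

lemma B_nonneg: "0 \<le> B"
  using P P_le_B by simp

text \<open>The cell is halved repeatedly, and only the half containing \<open>t\<close> is pursued, so each scale contributes
  one elementary increment and one defect. The second bound is needed when \<open>t\<close> is much closer to
  the left endpoint than the length of the cell.\<close>

lemma right_chain:
  assumes "k < 2 ^ n" "t \<in> dyadic_level T (n + p)"
    "real k * (T / 2 ^ n) < t" "t \<le> real (Suc k) * (T / 2 ^ n)"
  shows "norm (F (real k * (T / 2 ^ n)) t) \<le> B * (T / 2 ^ n) powr \<gamma>
    \<and> norm (F (real k * (T / 2 ^ n)) t) \<le> B * (2 * (t - real k * (T / 2 ^ n))) powr \<gamma>"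
  using assms
proof (induction p arbitrary: n k)
  case 0
  define h where "h = T / 2 ^ n"
  have h: "h > 0" using T by (simp add: h_def)
  from 0(2) obtain j where j: "t = real j * h"
    by (auto simp: dyadic_level_def h_def)
  \<comment> \<open>At depth 0, \<open>t\<close> is a grid point strictly after the left endpoint of
    the cell and not beyond the right one, hence equal to the latter.\<close>
  with 0(3,4) h have "j = Suc k"
    by (simp add: h_def[symmetric] del: of_nat_Suc)
  then have t: "t = real (Suc k) * h" using j by simp
  have "norm (F (real k * h) t) \<le> P * h powr \<gamma>"
    unfolding t using elem[OF 0(1)] by (simp add: h_def)
  also have "\<dots> \<le> B * h powr \<gamma>"
    by (intro mult_right_mono P_le_B) auto
  finally have 1: "norm (F (real k * h) t) \<le> B * h powr \<gamma>" .
  also have "\<dots> \<le> B * (2 * (t - real k * h)) powr \<gamma>"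
    using h \<gamma> B_nonneg by (intro mult_left_mono powr_mono2) (auto simp: t algebra_simps)
  finally show ?case
    using 1 by (simp add: h_def)
next
  case (Suc p)
  define h where "h = T / 2 ^ n"
  have h: "h > 0" using T by (simp add: h_def)
  have h2: "T / 2 ^ Suc n = h / 2" by (simp add: h_def)
  define s where "s = real k * h"
  define u where "u = real (Suc (2 * k)) * (h / 2)"
  have s2: "real (2 * k) * (h / 2) = s" by (simp add: s_def)
  have u: "u = s + h / 2" by (simp add: u_def s_def algebra_simps)
  have pw: "(h / 2) powr \<gamma> = 2 powr - \<gamma> * h powr \<gamma>"
    using h by (simp add: powr_divide powr_minus field_simps)
  have st: "s < t" "t \<le> s + h"
    using Suc.prems(3,4) by (auto simp: s_def h_def[symmetric] algebra_simps)
  have lv: "t \<in> dyadic_level T (Suc n + p)" using Suc.prems(2) by simp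
  have k: "2 * k < 2 ^ Suc n" "Suc (2 * k) < 2 ^ Suc n"
    using Suc.prems(1) by auto
  have half: "B * (h / 2) powr \<gamma> \<le> B * h powr \<gamma>"
    using h \<gamma> B_nonneg by (intro mult_left_mono powr_mono2) auto
  show ?case
  proof (cases "t \<le> u")
    case True
    have "real (2 * k) * (T / 2 ^ Suc n) < t"
      unfolding h2 s2 by (rule st)
    moreover have "t \<le> real (Suc (2 * k)) * (T / 2 ^ Suc n)"
      unfolding h2 using True by (simp only: u_def)
    ultimately have "norm (F s t) \<le> B * (h / 2) powr \<gamma> \<and> norm (F s t) \<le> B * (2 * (t - s)) powr \<gamma>"
      using Suc.IH[OF k(1) lv] unfolding h2 s2 by blast
    with half show ?thesis
      by (auto simp: s_def h_def)
  next
    case False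
    \<comment> \<open>The chain goes from \<open>s\<close> over the midpoint \<open>u\<close> to
      \<open>t\<close>. The first bound at the half scale suffices for \<open>F u t\<close>; the
      second bound for \<open>F s t\<close> then follows from the first, since
      \<open>h / 2 < t - s\<close>.\<close>
    have u': "u = real (Suc (2 * k)) * (T / 2 ^ Suc n)"
      unfolding h2 u_def ..
    have "t \<le> real (Suc (Suc (2 * k))) * (T / 2 ^ Suc n)"
      unfolding h2 using st by (simp add: s_def algebra_simps)
    then have ut: "norm (F u t) \<le> B * (h / 2) powr \<gamma>"
      using Suc.IH[OF k(2) lv] False unfolding u'[symmetric] unfolding h2 by auto
    have su: "norm (F s u) \<le> P * (h / 2) powr \<gamma>"
      using elem[OF k(1)] unfolding u'[symmetric] unfolding h2 s2 .
    have D: "s \<in> dyadic T" "u \<in> dyadic T" "t \<in> dyadic T"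
      using dyadic_grid_point[of k n T] Suc.prems(1) dyadic_grid_point[of "Suc (2*k)" "Suc n" T] k(2)
        Suc.prems(2) dyadic_level_subset unfolding u' s_def h_def by auto
    have "norm (F s t - F s u - F u t) \<le> Q * (t - s) powr \<gamma>"
      using defect[OF D] u h False by auto
    also have "\<dots> \<le> Q * h powr \<gamma>"
      using st \<gamma> Q by (intro mult_left_mono powr_mono2) auto
    finally have d: "norm (F s t - F s u - F u t) \<le> Q * h powr \<gamma>" .
    have "norm (F s t) = norm ((F s t - F s u - F u t) + F s u + F u t)"
      by simp
    also have "\<dots> \<le> norm (F s t - F s u - F u t) + norm (F s u) + norm (F u t)"
      by (intro order_trans[OF norm_triangle_ineq] add_mono order_refl)
    also have "\<dots> \<le> Q * h powr \<gamma> + P * h powr \<gamma> + B * (h / 2) powr \<gamma>"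
    proof -
      have "P * (h / 2) powr \<gamma> \<le> P * h powr \<gamma>"
        using h \<gamma> P by (intro mult_left_mono powr_mono2) auto
      then show ?thesis using d su ut by linarith
    qed
    also have "\<dots> = (P + Q + 2 powr - \<gamma> * B) * h powr \<gamma>"
      by (simp add: pw algebra_simps)
    finally have 1: "norm (F s t) \<le> B * h powr \<gamma>"
      by (simp only: B_fixpoint)
    also have "\<dots> \<le> B * (2 * (t - s)) powr \<gamma>"
      using h \<gamma> B_nonneg False u by (intro mult_left_mono powr_mono2) auto
    finally show ?thesis
      using 1 by (simp add: s_def h_def)
  qed
qed

lemma right_bound:
  assumes "k < 2 ^ n" "t \<in> dyadic T" "real k * (T / 2 ^ n) < t" "t \<le> real (Suc k) * (T / 2 ^ n)"
  shows "norm (F (real k * (T / 2 ^ n)) t) \<le> B * (2 * (t - real k * (T / 2 ^ n))) powr \<gamma>"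
proof -
  obtain m where "t \<in> dyadic_level T m"
    using assms(2) by (auto simp: dyadic_def)
  then have "t \<in> dyadic_level T (n + m)"
    using dyadic_level_mono[of m "n + m" T] by auto
  then show ?thesis
    using right_chain assms by blast
qed

text \<open>The hypotheses are symmetric under time reversal: cell \<open>k\<close> becomes cell
  \<open>2 ^ n - Suc k\<close>, and the two parts of a defect swap places. Thus
  \<open>left_bound\<close> is \<open>right_bound\<close> for the reversed function.\<close>

lemma reflect: "dyadic_chain T \<gamma> P Q (\<lambda>s t. F (T - t) (T - s))"
proof
  fix n k :: nat assume k: "k < 2 ^ n"
  have 1: "T - real k * (T / 2 ^ n) = real (Suc (2 ^ n - Suc k)) * (T / 2 ^ n)"
   and 2: "T - real (Suc k) * (T / 2 ^ n) = real (2 ^ n - Suc k) * (T / 2 ^ n)"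
    using k by (simp_all add: of_nat_diff field_simps)
  show "norm (F (T - real (Suc k) * (T / 2 ^ n)) (T - real k * (T / 2 ^ n))) \<le> P * (T / 2 ^ n) powr \<gamma>"
    unfolding 1 2 by (rule elem) (use k in simp)
next
  fix s u t assume "s \<in> dyadic T" "u \<in> dyadic T" "t \<in> dyadic T" "s < u" "u < t"
  then have "norm (F (T - t) (T - s) - F (T - t) (T - u) - F (T - u) (T - s)) \<le> Q * (T - s - (T - t)) powr \<gamma>"
    by (intro defect dyadic_reflect) auto
  then show "norm (F (T - t) (T - s) - F (T - u) (T - s) - F (T - t) (T - u)) \<le> Q * (t - s) powr \<gamma>"
    by (simp add: algebra_simps)
qed (use T \<gamma> P Q in auto)

lemma left_bound:
  assumes "k < 2 ^ n" "s \<in> dyadic T" "real k * (T / 2 ^ n) \<le> s" "s < real (Suc k) * (T / 2 ^ n)"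
  shows "norm (F s (real (Suc k) * (T / 2 ^ n))) \<le> B * (2 * (real (Suc k) * (T / 2 ^ n) - s)) powr \<gamma>"
proof -
  interpret refl: dyadic_chain T \<gamma> P Q "\<lambda>s t. F (T - t) (T - s)"
    by (rule reflect)
  have 1: "real (2 ^ n - Suc k) * (T / 2 ^ n) = T - real (Suc k) * (T / 2 ^ n)"
   and 2: "real (Suc (2 ^ n - Suc k)) * (T / 2 ^ n) = T - real k * (T / 2 ^ n)"
    using assms(1) by (simp_all add: of_nat_diff field_simps)
  have "2 ^ n - Suc k < 2 ^ n"
    using assms(1) by simp
  from refl.right_bound[OF this dyadic_reflect[OF assms(2)], unfolded 1 2]
  show ?thesis
    using assms(3,4) by simp
qed

text \<open>Descend into halves until the midpoint \<open>u\<close> of the current cell separates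
  \<open>s\<close> from \<open>t\<close>. As long as both lie in one half, the claim is inherited
  with the same constant, so nothing accumulates. At the separating midpoint,
  \<open>left_bound\<close> and \<open>right_bound\<close> control the two sides and a single defect
  joins them.\<close>

lemma chain_in_cell:
  assumes "k < 2 ^ n" "s \<in> dyadic_level T (n + p)" "t \<in> dyadic_level T (n + p)"
    "real k * (T / 2 ^ n) \<le> s" "s < t" "t \<le> real (Suc k) * (T / 2 ^ n)"
  shows "norm (F s t) \<le> (2 * (B * 2 powr \<gamma>) + Q) * (t - s) powr \<gamma>"
  using assms
proof (induction p arbitrary: n k)
  case 0
  define h where "h = T / 2 ^ n"
  have h: "h > 0" using T by (simp add: h_def)
  from 0(2,3) obtain i j where ij: "s = real i * h" "t = real j * h"
    by (auto simp: dyadic_level_def h_def)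
  with 0(4-) h have "i = k" "j = Suc k"
    by (simp_all add: h_def[symmetric] del: of_nat_Suc)
  with ij have st: "s = real k * h" "t = real (Suc k) * h" by simp_all
  have ts: "t - s = h" by (simp add: st algebra_simps)
  have "norm (F s t) \<le> P * h powr \<gamma>"
    unfolding st using elem[OF 0(1)] by (simp add: h_def)
  also have "\<dots> \<le> (2 * (B * 2 powr \<gamma>) + Q) * h powr \<gamma>"
  proof (rule mult_right_mono)
    have "B * 1 \<le> B * 2 powr \<gamma>"
      using \<gamma> B_nonneg by (intro mult_left_mono) (auto simp: ge_one_powr_ge_zero)
    then show "P \<le> 2 * (B * 2 powr \<gamma>) + Q"
      using P_le_B B_nonneg Q by linarith
  qed simp
  finally show ?case by (simp add: ts)
next
  case (Suc p)
  define h where "h = T / 2 ^ Suc n"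
  define u where "u = real (Suc (2 * k)) * (T / 2 ^ Suc n)"
  have k: "2 * k < 2 ^ Suc n" "Suc (2 * k) < 2 ^ Suc n"
    using Suc.prems(1) by auto
  have lv: "s \<in> dyadic_level T (Suc n + p)" "t \<in> dyadic_level T (Suc n + p)"
    using Suc.prems(2,3) by auto
  have ends: "real (2 * k) * (T / 2 ^ Suc n) = real k * (T / 2 ^ n)"
     "real (Suc (Suc (2 * k))) * (T / 2 ^ Suc n) = real (Suc k) * (T / 2 ^ n)"
    by (simp_all add: field_simps)
  have D: "s \<in> dyadic T" "u \<in> dyadic T" "t \<in> dyadic T"
    using lv dyadic_level_subset k(2) dyadic_grid_point[of "Suc (2*k)" "Suc n" T] unfolding u_def by auto
  consider "t \<le> u" | "u \<le> s" | "s < u" "u < t" by linarith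
  then show ?case
  proof cases
    case 1
    show ?thesis
      by (rule Suc.IH[OF k(1) lv]) (use 1 Suc.prems(4,5) ends in \<open>auto simp: u_def simp del: of_nat_Suc\<close>)
  next
    case 2
    show ?thesis
      by (rule Suc.IH[OF k(2) lv]) (use 2 Suc.prems(5,6) ends in \<open>auto simp: u_def simp del: of_nat_Suc\<close>)
  next
    case 3
    \<comment> \<open>The one-sided bounds involve twice the distance to \<open>u\<close>; comparing
      with \<open>t - s\<close> yields the factor \<open>2 powr \<gamma>\<close>.\<close>
    have mono: "B * (2 * r) powr \<gamma> \<le> B * 2 powr \<gamma> * (t - s) powr \<gamma>" if "0 \<le> r" "r \<le> t - s" for r
    proof -
      have "(2 * r) powr \<gamma> \<le> (2 * (t - s)) powr \<gamma>"
        using that \<gamma> by (intro powr_mono2) auto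
      also have "\<dots> = 2 powr \<gamma> * (t - s) powr \<gamma>"
        by (rule powr_mult)
      finally show ?thesis
        using B_nonneg by (simp add: mult.assoc mult_left_mono)
    qed
    have "norm (F s u) \<le> B * (2 * (u - s)) powr \<gamma>"
      unfolding u_def by (rule left_bound[OF k(1) D(1)])
        (use 3 Suc.prems(4) ends in \<open>auto simp: u_def simp del: of_nat_Suc\<close>)
    also have "\<dots> \<le> B * 2 powr \<gamma> * (t - s) powr \<gamma>"
      using 3 by (intro mono) auto
    finally have su: "norm (F s u) \<le> \<dots>" .
    have "norm (F u t) \<le> B * (2 * (t - u)) powr \<gamma>"
      unfolding u_def by (rule right_bound[OF k(2) D(3)])
        (use 3 Suc.prems(6) ends in \<open>auto simp: u_def simp del: of_nat_Suc\<close>)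
    also have "\<dots> \<le> B * 2 powr \<gamma> * (t - s) powr \<gamma>"
      using 3 by (intro mono) auto
    finally have ut: "norm (F u t) \<le> \<dots>" .
    have d: "norm (F s t - F s u - F u t) \<le> Q * (t - s) powr \<gamma>"
      by (rule defect[OF D 3])
    have "norm (F s t) = norm ((F s t - F s u - F u t) + F s u + F u t)"
      by simp
    also have "\<dots> \<le> norm (F s t - F s u - F u t) + norm (F s u) + norm (F u t)"
      by (intro order_trans[OF norm_triangle_ineq] add_mono order_refl)
    also have "\<dots> \<le> (2 * (B * 2 powr \<gamma>) + Q) * (t - s) powr \<gamma>"
      using d su ut by (simp add: algebra_simps)
    finally show ?thesis .
  qed
qed

end

text \<open>Depends on the exponent alone and is chosen so that
  \<open>chain_const \<gamma> * (P + Q)\<close> equals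
  \<open>2 * (B * 2 powr \<gamma>) + (P + Q)\<close>. The final bound is then linear in
  \<open>P + Q\<close>, which later allows a random factor to be pulled out.\<close>

definition chain_const :: "real \<Rightarrow> real" where
  "chain_const \<gamma> = 2 * 2 powr \<gamma> / (1 - 2 powr - \<gamma>) + 1"

lemma chain_const_nonneg: "\<gamma> > 0 \<Longrightarrow> 0 \<le> chain_const \<gamma>"
  using powr_less_mono[of "- \<gamma>" 0 2] by (auto simp: chain_const_def intro!: add_nonneg_nonneg divide_nonneg_nonneg)

lemma (in dyadic_chain) chain_bound:
  assumes "s \<in> dyadic T" "t \<in> dyadic T" "s < t"
  shows "norm (F s t) \<le> chain_const \<gamma> * (P + Q) * (t - s) powr \<gamma>"
proof -
  obtain m m' where "s \<in> dyadic_level T m" "t \<in> dyadic_level T m'"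
    using assms by (auto simp: dyadic_def)
  then have "s \<in> dyadic_level T (0 + max m m')" "t \<in> dyadic_level T (0 + max m m')"
    using dyadic_level_mono[of m "max m m'" T] dyadic_level_mono[of m' "max m m'" T] by auto
  \<comment> \<open>The only cell of level 0 is the whole interval from 0 to
    \<open>T\<close>.\<close>
  then have "norm (F s t) \<le> (2 * (B * 2 powr \<gamma>) + Q) * (t - s) powr \<gamma>"
    using dyadic_bounds[OF T] assms by (intro chain_in_cell[where k = 0 and n = 0]) auto
  also have "\<dots> \<le> chain_const \<gamma> * (P + Q) * (t - s) powr \<gamma>"
  proof (rule mult_right_mono)
    have "chain_const \<gamma> * (P + Q) = 2 * (B * 2 powr \<gamma>) + (P + Q)"
      by (simp add: chain_const_def B_def algebra_simps)
    then show "2 * (B * 2 powr \<gamma>) + Q \<le> chain_const \<gamma> * (P + Q)"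
      using P by simp
  qed simp
  finally show ?thesis .
qed

subsection \<open>Bounded bilinear maps in finite dimension\<close>

text \<open>A quantitative form of linear independence: the coordinate functionals on the span are
  bounded. In the induction below, this bound and closedness of the span alternate.\<close>

definition coords_bounded :: "'a::real_normed_vector set \<Rightarrow> bool" where
  "coords_bounded B \<longleftrightarrow>
     (\<exists>C\<ge>0. \<forall>c. \<forall>b\<in>B. \<bar>c b\<bar> \<le> C * norm (\<Sum>b\<in>B. c b *\<^sub>R b))"

text \<open>By the bound, the coordinates of a convergent sequence in the span are Cauchy, and
  completeness of the reals supplies the coordinates of the limit; the ambient space may be
  incomplete.\<close>

lemma closed_span_if_coords_bounded:
  fixes B :: "'a::real_normed_vector set"
  assumes "finite B" "coords_bounded B"
  shows "closed (span B)"
  unfolding closed_sequential_limits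
proof (intro allI impI, elim conjE)
  obtain C where C: "C \<ge> 0" "\<And>c b. b \<in> B \<Longrightarrow> \<bar>c b\<bar> \<le> C * norm (\<Sum>b\<in>B. c b *\<^sub>R b)"
    using assms(2) unfolding coords_bounded_def by blast
  fix x l assume x: "\<forall>n. x n \<in> span B" and lim: "x \<longlonglongrightarrow> l"
  have "\<forall>n. \<exists>c. x n = (\<Sum>b\<in>B. c b *\<^sub>R b)"
    using x span_finite[OF assms(1)] by auto
  then obtain c where c: "\<And>n. x n = (\<Sum>b\<in>B. c n b *\<^sub>R b)"
    by metis
  have "\<exists>d. (\<lambda>n. c n b) \<longlonglongrightarrow> d" if b: "b \<in> B" for b
  proof -
    have "Cauchy (\<lambda>n. c n b)"
    proof (rule metric_CauchyI)
      fix e :: real assume e: "e > 0"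
      \<comment> \<open>\<open>C\<close> may be 0, hence the divisor \<open>C + 1\<close>.\<close>
      then have "e / (C + 1) > 0" using C(1) by simp
      then obtain N where N: "\<And>m n. m \<ge> N \<Longrightarrow> n \<ge> N \<Longrightarrow> dist (x m) (x n) < e / (C + 1)"
        using LIMSEQ_imp_Cauchy[OF lim] unfolding Cauchy_def by blast
      have "dist (c m b) (c n b) < e" if "m \<ge> N" "n \<ge> N" for m n
      proof -
        have "\<bar>c m b - c n b\<bar> \<le> C * norm (\<Sum>b\<in>B. (c m b - c n b) *\<^sub>R b)"
          using C(2)[OF b, of "\<lambda>b. c m b - c n b"] .
        also have "(\<Sum>b\<in>B. (c m b - c n b) *\<^sub>R b) = x m - x n"
          by (simp add: c scaleR_diff_left sum_subtractf)
        also have "C * norm (x m - x n) \<le> (C + 1) * norm (x m - x n)"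
          by (intro mult_right_mono) auto
        also have "\<dots> < (C + 1) * (e / (C + 1))"
          using N[OF that] C(1) by (intro mult_strict_left_mono) (auto simp: dist_norm)
        also have "\<dots> = e" using C(1) by simp
        finally show ?thesis by (simp add: dist_real_def)
      qed
      then show "\<exists>N. \<forall>m\<ge>N. \<forall>n\<ge>N. dist (c m b) (c n b) < e" by blast
    qed
    then show ?thesis
      by (simp add: real_Cauchy_convergent convergent_def[symmetric])
  qed
  then obtain d where d: "\<And>b. b \<in> B \<Longrightarrow> (\<lambda>n. c n b) \<longlonglongrightarrow> d b"
    by metis
  have "x \<longlonglongrightarrow> (\<Sum>b\<in>B. d b *\<^sub>R b)"
    unfolding c[abs_def] by (intro tendsto_sum tendsto_scaleR d tendsto_const)
  then have "l = (\<Sum>b\<in>B. d b *\<^sub>R b)"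
    using lim LIMSEQ_unique by blast
  then show "l \<in> span B"
    by (simp add: span_sum span_scale span_base)
qed

text \<open>The closed span of \<open>B\<close> keeps a positive distance \<open>d\<close> from the
  new vector \<open>a\<close>. This bounds the coefficient of \<open>a\<close> by
  \<open>1 / d\<close> times the norm of the whole sum; once the \<open>a\<close> term is
  subtracted, the induction hypothesis bounds the other coefficients.\<close>

lemma coords_bounded_independent:
  fixes B :: "'a::real_normed_vector set"
  assumes "finite B" "independent B"
  shows "coords_bounded B"
  using assms
proof (induction B rule: finite_induct)
  case empty
  show ?case by (auto simp: coords_bounded_def)
next
  case (insert a B)
  have indep: "independent B" and a: "a \<notin> span B"
    using insert.prems insert.hyps(2) by (auto simp: independent_insert)
  have IH: "coords_bounded B" by (rule insert.IH[OF indep])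
  obtain C where C: "C \<ge> 0" "\<And>c b. b \<in> B \<Longrightarrow> \<bar>c b\<bar> \<le> C * norm (\<Sum>b\<in>B. c b *\<^sub>R b)"
    using IH unfolding coords_bounded_def by blast
  have "open (- span B)"
    using closed_span_if_coords_bounded[OF insert.hyps(1) IH] by (simp add: open_Compl)
  then obtain d where d: "d > 0" "ball a d \<subseteq> - span B"
    using a openE by (metis ComplI)
  have dist: "d \<le> norm (a - y)" if "y \<in> span B" for y
    using d that by (force simp: dist_norm subset_iff not_le)
  have a_coord: "\<bar>c a\<bar> \<le> (1 / d) * norm (c a *\<^sub>R a + y)" if "y \<in> span B" for c y
  proof (cases "c a = 0")
    case False
    have "d * \<bar>c a\<bar> \<le> norm (a - (- (1 / c a)) *\<^sub>R y) * \<bar>c a\<bar>"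
      by (intro mult_right_mono dist span_scale that) simp
    also have "\<dots> = norm (c a *\<^sub>R (a - (- (1 / c a)) *\<^sub>R y))"
      by simp
    also have "c a *\<^sub>R (a - (- (1 / c a)) *\<^sub>R y) = c a *\<^sub>R a + y"
      using False by (simp add: scaleR_add_right)
    finally show ?thesis
      using d(1) by (simp add: field_simps)
  qed (use d in auto)
  \<comment> \<open>The first entry serves the coefficient of \<open>a\<close>, the second one the
    others, via \<open>norm y \<le> norm x + \<bar>c a\<bar> * norm a\<close>.\<close>
  define C' where "C' = max (1 / d) (C * (1 + norm a / d))"
  show ?case
    unfolding coords_bounded_def
  proof (intro exI[of _ C'] conjI allI ballI)
    show "C' \<ge> 0" using d by (simp add: C'_def le_max_iff_disj)
    fix c b assume b: "b \<in> insert a B"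
    define y where "y = (\<Sum>b\<in>B. c b *\<^sub>R b)"
    have y: "y \<in> span B"
      by (simp add: y_def span_sum span_scale span_base)
    define x where "x = (\<Sum>b\<in>insert a B. c b *\<^sub>R b)"
    have x: "x = c a *\<^sub>R a + y"
      by (simp add: x_def y_def insert.hyps)
    have ca: "\<bar>c a\<bar> \<le> (1 / d) * norm x"
      unfolding x by (rule a_coord[OF y])
    have "\<bar>c b\<bar> \<le> C' * norm x"
    proof (cases "b = a")
      case True
      have "(1 / d) * norm x \<le> C' * norm x"
        by (intro mult_right_mono) (auto simp: C'_def)
      then show ?thesis using ca True by simp
    next
      case False
      then have "\<bar>c b\<bar> \<le> C * norm y"
        using C(2)[of b c] b by (simp add: y_def)
      also have "norm y = norm (x - c a *\<^sub>R a)"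
        by (simp add: x)
      also have "\<dots> \<le> norm x + \<bar>c a\<bar> * norm a"
        using norm_triangle_ineq4[of x "c a *\<^sub>R a"] by simp
      also have "\<dots> \<le> norm x + (1 / d) * norm x * norm a"
        by (intro add_left_mono mult_right_mono ca) auto
      also have "\<dots> = (1 + norm a / d) * norm x"
        by (simp add: algebra_simps)
      finally have "\<bar>c b\<bar> \<le> C * (1 + norm a / d) * norm x"
        using C(1) by (simp add: mult_left_mono mult.assoc)
      also have "\<dots> \<le> C' * norm x"
        by (intro mult_right_mono) (auto simp: C'_def)
      finally show ?thesis .
    qed
    then show "\<bar>c b\<bar> \<le> C' * norm (\<Sum>b\<in>insert a B. c b *\<^sub>R b)"
      by (simp only: x_def)
  qed
qed

lemma finite_dim_coords:
  assumes "finite_dim (UNIV :: 'a::real_normed_vector set)"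
  obtains B :: "'a::real_normed_vector set" and C
    and c :: "'a::real_normed_vector \<Rightarrow> 'a::real_normed_vector \<Rightarrow> real" where "finite B" "C \<ge> 0"
    "\<And>x. (\<Sum>b\<in>B. c x b *\<^sub>R b) = x" "\<And>x b. b \<in> B \<Longrightarrow> \<bar>c x b\<bar> \<le> C * norm x"
proof -
  obtain S :: "'a set" where S: "finite S" "UNIV \<subseteq> span S"
    using assms by (auto simp: finite_dim_def)
  obtain B where B: "B \<subseteq> S" "independent B" "S \<subseteq> span B"
    by (metis maximal_independent_subset)
  have fin: "finite B" using B(1) S(1) finite_subset by blast
  have "span B = UNIV"
    using B(3) S(2) by (metis span_mono span_span top.extremum_unique)
  then have range: "range (\<lambda>c. \<Sum>b\<in>B. c b *\<^sub>R b) = UNIV"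
    using span_finite[OF fin] by simp
  define c where "c x = (SOME c. (\<Sum>b\<in>B. c b *\<^sub>R b) = x)" for x
  have c: "(\<Sum>b\<in>B. c x b *\<^sub>R b) = x" for x
  proof -
    have "x \<in> range (\<lambda>c. \<Sum>b\<in>B. c b *\<^sub>R b)"
      unfolding range by simp
    then have "\<exists>c. (\<Sum>b\<in>B. c b *\<^sub>R b) = x"
      by blast
    then show ?thesis
      unfolding c_def by (rule someI_ex)
  qed
  obtain C where C: "C \<ge> 0" "\<And>c b. b \<in> B \<Longrightarrow> \<bar>c b\<bar> \<le> C * norm (\<Sum>b\<in>B. c b *\<^sub>R b)"
    using coords_bounded_independent[OF fin B(2)] unfolding coords_bounded_def by blast
  have "\<bar>c x b\<bar> \<le> C * norm x" if "b \<in> B" for x b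
    using C(2)[OF that, of "c x"] unfolding c .
  then show thesis
    by (rule that[OF fin C(1) c])
qed

text \<open>\<open>tensor_product\<close> says nothing about norms, so an estimate of the tensor
  maps has to come from finite dimension: expanding both arguments in bases leaves finitely many
  values \<open>f b b'\<close>, and the coordinates are bounded by the norms.\<close>

lemma bilinear_bounded_finite_dim:
  fixes f :: "'a::real_normed_vector \<Rightarrow> 'b::real_normed_vector \<Rightarrow> 'c::real_normed_vector"
  assumes f: "bilinear f"
    and "finite_dim (UNIV :: 'a set)" "finite_dim (UNIV :: 'b set)"
  obtains K where "K \<ge> 0" "\<And>x y. norm (f x y) \<le> K * norm x * norm y"
proof -
  obtain B C and c :: "'a \<Rightarrow> 'a \<Rightarrow> real" where B: "finite B" "C \<ge> 0"
    "\<And>x. (\<Sum>b\<in>B. c x b *\<^sub>R b) = x" "\<And>x b. b \<in> B \<Longrightarrow> \<bar>c x b\<bar> \<le> C * norm x"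
    by (rule finite_dim_coords[OF assms(2)]) blast
  obtain B' C' and c' :: "'b \<Rightarrow> 'b \<Rightarrow> real" where B': "finite B'" "C' \<ge> 0"
    "\<And>x. (\<Sum>b\<in>B'. c' x b *\<^sub>R b) = x" "\<And>x b. b \<in> B' \<Longrightarrow> \<bar>c' x b\<bar> \<le> C' * norm x"
    by (rule finite_dim_coords[OF assms(3)]) blast
  define K where "K = (\<Sum>(b, b')\<in>B \<times> B'. C * C' * norm (f b b'))"
  show thesis
  proof (rule that[of K])
    show "K \<ge> 0"
      using B(2) B'(2) by (auto simp: K_def intro!: sum_nonneg)
    fix x y
    have "f x y = f (\<Sum>b\<in>B. c x b *\<^sub>R b) (\<Sum>b\<in>B'. c' y b *\<^sub>R b)"
      by (simp only: B(3) B'(3))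
    also have "\<dots> = (\<Sum>(b, b')\<in>B \<times> B'. f (c x b *\<^sub>R b) (c' y b' *\<^sub>R b'))"
      by (rule bilinear_sum[OF f])
    finally have "norm (f x y) \<le> (\<Sum>(b, b')\<in>B \<times> B'. norm (f (c x b *\<^sub>R b) (c' y b' *\<^sub>R b')))"
      by (simp add: case_prod_unfold) (rule norm_sum)
    also have "\<dots> = (\<Sum>(b, b')\<in>B \<times> B'. \<bar>c x b\<bar> * \<bar>c' y b'\<bar> * norm (f b b'))"
      by (simp add: bilinear_lmul[OF f] bilinear_rmul[OF f] abs_mult mult_ac)
    also have "\<dots> \<le> (\<Sum>(b, b')\<in>B \<times> B'. (C * norm x) * (C' * norm y) * norm (f b b'))"
      using B B' by (intro sum_mono) (auto intro!: mult_mono)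
    also have "\<dots> = K * norm x * norm y"
      by (simp add: K_def sum_distrib_left sum_distrib_right case_prod_unfold mult_ac)
    finally show "norm (f x y) \<le> K * norm x * norm y" .
  qed
qed

text \<open>Called for because the left factor of the second tensor map is itself a tensor product.
  The finitely many \<open>tens b b'\<close> span: a functional vanishing on them vanishes on every
  \<open>tens x y\<close>, so it is 0 by uniqueness in the universal property, whereas a vector
  outside their span would be separated from it by a nonzero functional.\<close>

lemma finite_dim_tensor_product:
  fixes tens :: "'a::real_vector \<Rightarrow> 'b::real_vector \<Rightarrow> 'c::real_vector"
  assumes "tensor_product tens" "finite_dim (UNIV :: 'a set)" "finite_dim (UNIV :: 'b set)"
  shows "finite_dim (UNIV :: 'c set)"
proof -
  have bil: "bilinear tens"
    and uni: "\<And>\<phi> :: 'a \<Rightarrow> 'b \<Rightarrow> real. bilinear \<phi> \<Longrightarrow> \<exists>!L. linear L \<and> (\<forall>x y. L (tens x y) = \<phi> x y)"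
    using assms(1) by (auto simp: tensor_product_def)
  obtain B :: "'a set" where B: "finite B" "UNIV \<subseteq> span B"
    using assms(2) by (auto simp: finite_dim_def)
  obtain B' :: "'b set" where B': "finite B'" "UNIV \<subseteq> span B'"
    using assms(3) by (auto simp: finite_dim_def)
  define S where "S = (\<lambda>(b, b'). tens b b') ` (B \<times> B')"
  have in_S: "tens x y \<in> span S" for x y
  proof -
    have "x \<in> span B" "y \<in> span B'" using B B' by auto
    then obtain c c' where c: "x = (\<Sum>b\<in>B. c b *\<^sub>R b)" "y = (\<Sum>b\<in>B'. c' b *\<^sub>R b)"
      using span_finite[OF B(1)] span_finite[OF B'(1)] by auto
    have "tens x y = (\<Sum>(b, b')\<in>B \<times> B'. tens (c b *\<^sub>R b) (c' b' *\<^sub>R b'))"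
      unfolding c by (rule bilinear_sum[OF bil])
    also have "\<dots> = (\<Sum>(b, b')\<in>B \<times> B'. c b *\<^sub>R c' b' *\<^sub>R tens b b')"
      by (simp add: bilinear_lmul[OF bil] bilinear_rmul[OF bil] mult.commute)
    also have "\<dots> \<in> span S"
    proof (intro span_sum, clarify)
      fix b b' assume "b \<in> B" "b' \<in> B'"
      then have "tens b b' \<in> S" by (force simp: S_def)
      then show "c b *\<^sub>R c' b' *\<^sub>R tens b b' \<in> span S"
        by (intro span_scale span_base)
    qed
    finally show ?thesis .
  qed
  have "z \<in> span S" for z
  proof (rule ccontr)
    assume "z \<notin> span S"
    then obtain l :: "'c \<Rightarrow> real" where l: "linear l" "\<And>x. x \<in> S \<Longrightarrow> l x = 0" "l z = 1"
      using linear_functional_separates[of z S] by metis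
    have "l (tens x y) = 0" for x y
      using linear_eq_0_on_span[OF l(1,2) in_S] .
    moreover have "bilinear (\<lambda>(x::'a) (y::'b). 0::real)"
      by (simp add: bilinear_def linear_iff)
    ultimately have "l = (\<lambda>_. 0)"
      using uni[of "\<lambda>_ _. 0"] l(1) linear_zero by blast
    with l(3) show False by simp
  qed
  moreover have "finite S" using B(1) B'(1) by (simp add: S_def)
  ultimately show ?thesis
    unfolding finite_dim_def by blast
qed

subsection \<open>From dyadic to arbitrary times\<close>

text \<open>If the bound failed at \<open>a\<close>, the difference of \<open>g\<close> and the norm
  of \<open>f\<close> would be negative at \<open>a\<close>, hence by right-continuity also at some
  dyadic point just to the right of \<open>a\<close>.\<close>

lemma norm_le_at_right_limit:
  fixes f :: "real \<Rightarrow> 'a::real_normed_vector" and g :: "real \<Rightarrow> real"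
  assumes T: "T > 0" and ab: "0 \<le> a" "a < b" "b \<le> T" "{a<..<b} \<subseteq> I"
    and f: "(f \<longlongrightarrow> f a) (at a within I \<inter> {a<..})" and g: "isCont g a"
    and le: "\<And>d. d \<in> dyadic T \<Longrightarrow> a < d \<Longrightarrow> d < b \<Longrightarrow> norm (f d) \<le> g d"
  shows "norm (f a) \<le> g a"
proof (rule ccontr)
  assume "\<not> norm (f a) \<le> g a"
  then have neg: "g a - norm (f a) < 0" by simp
  have "(g \<longlongrightarrow> g a) (at a within I \<inter> {a<..})"
    using g unfolding isCont_def by (rule tendsto_within_subset) simp
  then have "((\<lambda>x. g x - norm (f x)) \<longlongrightarrow> g a - norm (f a)) (at a within I \<inter> {a<..})"
    by (intro tendsto_diff tendsto_norm f)
  from order_tendstoD(2)[OF this neg] obtain e where e: "e > 0"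
    "\<And>x. x \<in> I \<inter> {a<..} \<Longrightarrow> x \<noteq> a \<Longrightarrow> dist x a < e \<Longrightarrow> g x - norm (f x) < 0"
    unfolding eventually_at by blast
  obtain d where d: "d \<in> dyadic T" "a < d" "d < min b (a + e)"
  proof (rule dyadic_dense[OF T ab(1), of "min b (a + e)"])
    show "a < min b (a + e)" "min b (a + e) \<le> T"
      using ab e(1) by auto
  qed
  then have "g d - norm (f d) < 0"
    using ab(4) by (intro e(2)) (auto simp: dist_real_def)
  with le[of d] d show False by simp
qed

text \<open>Two successive right limits: in \<open>t\<close> with \<open>s\<close> dyadic, then in
  \<open>s\<close> with \<open>t\<close> arbitrary. Each uses right-continuity in one variable with
  the other fixed, which is what \<open>cadlag_process2\<close> offers.\<close>

lemma extend_dyadic_bound: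
  fixes F :: "real \<Rightarrow> real \<Rightarrow> 'a::real_normed_vector"
  assumes T: "T > 0"
    and bound: "\<And>s t. s \<in> dyadic T \<Longrightarrow> t \<in> dyadic T \<Longrightarrow> s < t \<Longrightarrow> norm (F s t) \<le> K * (t - s) powr \<gamma>"
    and right_t: "\<And>s t. 0 \<le> s \<Longrightarrow> s < t \<Longrightarrow> t < T \<Longrightarrow> (F s \<longlongrightarrow> F s t) (at t within {s<..T} \<inter> {t<..})"
    and right_s: "\<And>s t. 0 \<le> s \<Longrightarrow> s < t \<Longrightarrow> t \<le> T \<Longrightarrow>
      ((\<lambda>s. F s t) \<longlongrightarrow> F s t) (at s within {0..<t} \<inter> {s<..})"
    and st: "0 \<le> s" "s < t" "t \<le> T"
  shows "norm (F s t) \<le> K * (t - s) powr \<gamma>"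
proof -
  \<comment> \<open>\<open>T\<close> cannot be approached from the right inside the interval, but it
    is itself dyadic, so \<open>bound\<close> applies there directly.\<close>
  have dyadic_s: "norm (F s t) \<le> K * (t - s) powr \<gamma>" if s: "s \<in> dyadic T" and st: "s < t" "t \<le> T" for s t
  proof (cases "t = T")
    case True
    then show ?thesis using bound[OF s T_in_dyadic] st by simp
  next
    case False
    have s0: "0 \<le> s" using dyadic_bounds[OF T s] by simp
    show ?thesis
      by (rule norm_le_at_right_limit[where f = "F s" and g = "\<lambda>t. K * (t - s) powr \<gamma>" and b = T and I = "{s<..T}", OF T])
         (use False s s0 st in \<open>auto intro!: bound right_t continuous_intros\<close>)
  qed
  show ?thesis
    by (rule norm_le_at_right_limit[where f = "\<lambda>s. F s t" and g = "\<lambda>s. K * (t - s) powr \<gamma>" and b = t and I = "{0..<t}", OF T])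
       (use st in \<open>auto intro!: dyadic_s right_s continuous_intros\<close>)
qed

subsection \<open>Pathwise estimates for the three levels\<close>

text \<open>Chen's relation respects the grading by levels, 1 + 1 = 2 and 2 + 1 = 3, so every defect
  carries the power of \<open>R\<close> and the exponent of its own level. The factors
  \<open>1 + L1 * c1\<^sup>2\<close> and \<open>1 + L * c2 * c1\<close> are what remains of
  \<open>P + Q\<close> once \<open>R\<^sup>2\<close> or \<open>R ^ 3\<close> is factored
  out.\<close>

lemma dyadic_rough_bounds:
  fixes X11 :: "real \<Rightarrow> 'v11::real_normed_vector" and X12 :: "real \<Rightarrow> 'v12::real_normed_vector"
    and X2 :: "real \<Rightarrow> 'v2::real_normed_vector"
    and A1 :: "real \<Rightarrow> real \<Rightarrow> 'w::real_normed_vector" and A :: "real \<Rightarrow> real \<Rightarrow> 'z::real_normed_vector"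
    and tens1 :: "'v11 \<Rightarrow> 'v12 \<Rightarrow> 'w" and tens :: "'w \<Rightarrow> 'v2 \<Rightarrow> 'z"
    and T \<gamma> R L1 L :: real
  defines "h \<equiv> \<lambda>n. T / 2 ^ n"
  assumes T: "T > 0" and \<gamma>: "\<gamma> > 0" and R: "R \<ge> 0" and L: "L1 \<ge> 0" "L \<ge> 0"
    and tens1: "\<And>x y. norm (tens1 x y) \<le> L1 * norm x * norm y"
    and tens: "\<And>x y. norm (tens x y) \<le> L * norm x * norm y"
    and X11: "\<And>n k. k < 2 ^ n \<Longrightarrow> norm (X11 (real (Suc k) * h n) - X11 (real k * h n)) \<le> R * h n powr \<gamma>"
    and X12: "\<And>n k. k < 2 ^ n \<Longrightarrow> norm (X12 (real (Suc k) * h n) - X12 (real k * h n)) \<le> R * h n powr \<gamma>"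
    and X2: "\<And>n k. k < 2 ^ n \<Longrightarrow> norm (X2 (real (Suc k) * h n) - X2 (real k * h n)) \<le> R * h n powr \<gamma>"
    and A1: "\<And>n k. k < 2 ^ n \<Longrightarrow> norm (A1 (real k * h n) (real (Suc k) * h n)) \<le> R\<^sup>2 * h n powr (2 * \<gamma>)"
    and A: "\<And>n k. k < 2 ^ n \<Longrightarrow> norm (A (real k * h n) (real (Suc k) * h n)) \<le> R ^ 3 * h n powr (3 * \<gamma>)"
    and Chen1: "\<And>s u t. s \<in> dyadic T \<Longrightarrow> u \<in> dyadic T \<Longrightarrow> t \<in> dyadic T \<Longrightarrow> s < u \<Longrightarrow> u < t \<Longrightarrow>
      A1 s t - A1 s u - A1 u t = tens1 (X11 u - X11 s) (X12 t - X12 u)"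
    and Chen: "\<And>s u t. s \<in> dyadic T \<Longrightarrow> u \<in> dyadic T \<Longrightarrow> t \<in> dyadic T \<Longrightarrow> s < u \<Longrightarrow> u < t \<Longrightarrow>
      A s t - A s u - A u t = tens (A1 s u) (X2 t - X2 u)"
    and st: "s \<in> dyadic T" "t \<in> dyadic T" "s < t"
  defines "c1 \<equiv> chain_const \<gamma>"
  defines "c2 \<equiv> chain_const (2 * \<gamma>) * (1 + L1 * c1\<^sup>2)"
  defines "c3 \<equiv> chain_const (3 * \<gamma>) * (1 + L * c2 * c1)"
  shows "norm (X11 t - X11 s) \<le> c1 * R * (t - s) powr \<gamma>"
    and "norm (X12 t - X12 s) \<le> c1 * R * (t - s) powr \<gamma>"
    and "norm (X2 t - X2 s) \<le> c1 * R * (t - s) powr \<gamma>"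
    and "norm (A1 s t) \<le> c2 * R\<^sup>2 * (t - s) powr (2 * \<gamma>)"
    and "norm (A s t) \<le> c3 * R ^ 3 * (t - s) powr (3 * \<gamma>)"
proof -
  have c1: "c1 \<ge> 0" using chain_const_nonneg \<gamma> by (simp add: c1_def)
  have c2: "c2 \<ge> 0" using chain_const_nonneg \<gamma> L c1 by (simp add: c2_def)
  \<comment> \<open>Increments of a path are additive, so level 1 has no defect and
    \<open>Q = 0\<close>.\<close>
  interpret X11: dyadic_chain T \<gamma> R 0 "\<lambda>s t. X11 t - X11 s"
    by unfold_locales (use T \<gamma> R X11 in \<open>auto simp: h_def\<close>)
  interpret X12: dyadic_chain T \<gamma> R 0 "\<lambda>s t. X12 t - X12 s"
    by unfold_locales (use T \<gamma> R X12 in \<open>auto simp: h_def\<close>)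
  interpret X2: dyadic_chain T \<gamma> R 0 "\<lambda>s t. X2 t - X2 s"
    by unfold_locales (use T \<gamma> R X2 in \<open>auto simp: h_def\<close>)
  have X11: "norm (X11 t - X11 s) \<le> c1 * R * (t - s) powr \<gamma>"
    and X12: "norm (X12 t - X12 s) \<le> c1 * R * (t - s) powr \<gamma>"
    and X2: "norm (X2 t - X2 s) \<le> c1 * R * (t - s) powr \<gamma>"
    if "s \<in> dyadic T" "t \<in> dyadic T" "s < t" for s t
    using X11.chain_bound[OF that] X12.chain_bound[OF that] X2.chain_bound[OF that] by (simp_all add: c1_def)
  show "norm (X11 t - X11 s) \<le> c1 * R * (t - s) powr \<gamma>"
    "norm (X12 t - X12 s) \<le> c1 * R * (t - s) powr \<gamma>"
    "norm (X2 t - X2 s) \<le> c1 * R * (t - s) powr \<gamma>"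
    using X11[OF st] X12[OF st] X2[OF st] by auto
  have mono: "(v - u) powr a \<le> (t - s) powr a" if "s \<le> u" "u < v" "v \<le> t" "a > 0" for s t u v a :: real
    using that by (intro powr_mono2) auto
  interpret A1: dyadic_chain T "2 * \<gamma>" "R\<^sup>2" "L1 * c1\<^sup>2 * R\<^sup>2" A1
  proof
    fix s u t assume D: "s \<in> dyadic T" "u \<in> dyadic T" "t \<in> dyadic T" and lt: "s < u" "u < t"
    have "norm (A1 s t - A1 s u - A1 u t) \<le> L1 * norm (X11 u - X11 s) * norm (X12 t - X12 u)"
      unfolding Chen1[OF D lt] by (rule tens1)
    also have "\<dots> \<le> L1 * (c1 * R * (u - s) powr \<gamma>) * (c1 * R * (t - u) powr \<gamma>)"
      using L c1 R X11[OF D(1,2) lt(1)] X12[OF D(2,3) lt(2)] by (intro mult_mono mult_nonneg_nonneg) auto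
    \<comment> \<open>Both subintervals are enlarged to the one from \<open>s\<close> to
      \<open>t\<close>, where the exponents add up to \<open>2 * \<gamma>\<close>.\<close>
    also have "\<dots> \<le> L1 * (c1 * R * (t - s) powr \<gamma>) * (c1 * R * (t - s) powr \<gamma>)"
      using L c1 R lt \<gamma> by (intro mult_mono mult_nonneg_nonneg mono) auto
    also have "\<dots> = L1 * c1\<^sup>2 * R\<^sup>2 * ((t - s) powr \<gamma> * (t - s) powr \<gamma>)"
      by (simp add: power2_eq_square)
    also have "(t - s) powr \<gamma> * (t - s) powr \<gamma> = (t - s) powr (2 * \<gamma>)"
      by (simp flip: powr_add)
    finally show "norm (A1 s t - A1 s u - A1 u t) \<le> L1 * c1\<^sup>2 * R\<^sup>2 * (t - s) powr (2 * \<gamma>)" .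
  qed (use T \<gamma> R L A1 in \<open>auto simp: h_def\<close>)
  have A1: "norm (A1 s t) \<le> c2 * R\<^sup>2 * (t - s) powr (2 * \<gamma>)"
    if "s \<in> dyadic T" "t \<in> dyadic T" "s < t" for s t
    using A1.chain_bound[OF that] by (simp add: c2_def algebra_simps)
  show "norm (A1 s t) \<le> c2 * R\<^sup>2 * (t - s) powr (2 * \<gamma>)"
    by (rule A1[OF st])
  \<comment> \<open>The defect pairs level 2 on the left subinterval with level 1 on the right one,
    so the exponents add up to \<open>3 * \<gamma>\<close>.\<close>
  interpret A: dyadic_chain T "3 * \<gamma>" "R ^ 3" "L * c2 * c1 * R ^ 3" A
  proof
    fix s u t assume D: "s \<in> dyadic T" "u \<in> dyadic T" "t \<in> dyadic T" and lt: "s < u" "u < t"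
    have "norm (A s t - A s u - A u t) \<le> L * norm (A1 s u) * norm (X2 t - X2 u)"
      unfolding Chen[OF D lt] by (rule tens)
    also have "\<dots> \<le> L * (c2 * R\<^sup>2 * (u - s) powr (2 * \<gamma>)) * (c1 * R * (t - u) powr \<gamma>)"
      using L c1 c2 R A1[OF D(1,2) lt(1)] X2[OF D(2,3) lt(2)] by (intro mult_mono mult_nonneg_nonneg) auto
    also have "\<dots> \<le> L * (c2 * R\<^sup>2 * (t - s) powr (2 * \<gamma>)) * (c1 * R * (t - s) powr \<gamma>)"
      using L c1 c2 R lt \<gamma> by (intro mult_mono mult_nonneg_nonneg mono) auto
    also have "\<dots> = L * c2 * c1 * R ^ 3 * ((t - s) powr (2 * \<gamma>) * (t - s) powr \<gamma>)"
      by (simp add: power2_eq_square power3_eq_cube)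
    also have "(t - s) powr (2 * \<gamma>) * (t - s) powr \<gamma> = (t - s) powr (3 * \<gamma>)"
      by (simp flip: powr_add)
    finally show "norm (A s t - A s u - A u t) \<le> L * c2 * c1 * R ^ 3 * (t - s) powr (3 * \<gamma>)" .
  qed (use T \<gamma> R L c1 c2 A in \<open>auto simp: h_def\<close>)
  show "norm (A s t) \<le> c3 * R ^ 3 * (t - s) powr (3 * \<gamma>)"
    using A.chain_bound[OF st] by (simp add: c3_def algebra_simps)
qed

subsection \<open>Moment estimates\<close>

text \<open>A single term of a nonnegative series is at most the sum, so one sum handles all cells
  at all scales. The \<open>2 ^ n = T / h\<close> cells of a scale cost one power of
  \<open>h\<close>, the moments give \<open>h powr (q * \<beta>)\<close> and the weight takes away
  \<open>q * \<gamma>\<close>; \<open>gap\<close> leaves a positive power of \<open>h\<close>, hence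
  a geometric series.\<close>

lemma dyadic_moment_bound:
  fixes Z :: "nat \<Rightarrow> nat \<Rightarrow> '\<omega> \<Rightarrow> 'a::{banach, second_countable_topology}"
  assumes T: "T > 0" and q: "q > 0" and l: "l > 0" and gap: "(\<beta> - \<gamma>) * q > 1"
    and Z: "\<And>n k. k < 2 ^ n \<Longrightarrow> Z n k \<in> Lq_space M (q / l)"
    and norm_Z: "\<And>n k. k < 2 ^ n \<Longrightarrow> Lq_norm M (q / l) (Z n k) \<le> C * (T / 2 ^ n) powr (l * \<beta>)"
  obtains H where "integrable M H" "\<And>\<omega>. H \<omega> \<ge> 0"
    "AE \<omega> in M. \<forall>n. \<forall>k<2 ^ n. norm (Z n k \<omega>) \<le> H \<omega> powr (l / q) * (T / 2 ^ n) powr (l * \<gamma>)"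
proof -
  define h where "h n = T / 2 ^ n" for n :: nat
  have h: "h n > 0" for n using T by (simp add: h_def)
  define p where "p = q / l"
  have p: "p > 0" using q l by (simp add: p_def)
  define Y where "Y n k \<omega> = norm (Z n k \<omega>) powr p" for n k \<omega>
  have int_Y: "integrable M (Y n k)" if "k < 2 ^ n" for n k
    using Z[OF that] by (simp add: Lq_space_def Y_def[abs_def] p_def)
  \<comment> \<open>\<open>C\<close> has no sign assumption, hence \<open>\<bar>C\<bar>\<close>.
    Raising to the power \<open>p = q / l\<close> turns \<open>l * \<beta>\<close> into
    \<open>q * \<beta>\<close>, the same exponent at every level.\<close>
  have mom: "integral\<^sup>L M (Y n k) \<le> \<bar>C\<bar> powr p * h n powr (q * \<beta>)" if k: "k < 2 ^ n" for n k
  proof -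
    have nn: "0 \<le> integral\<^sup>L M (Y n k)"
      by (simp add: Y_def)
    have "integral\<^sup>L M (Y n k) = (integral\<^sup>L M (Y n k) powr (1 / p)) powr p"
      using p nn by (simp add: powr_powr)
    also have "\<dots> \<le> (\<bar>C\<bar> * h n powr (l * \<beta>)) powr p"
    proof (rule powr_mono2)
      have "integral\<^sup>L M (Y n k) powr (1 / p) \<le> C * h n powr (l * \<beta>)"
        using norm_Z[OF k] by (simp add: Lq_norm_def Y_def[abs_def] p_def h_def)
      also have "\<dots> \<le> \<bar>C\<bar> * h n powr (l * \<beta>)"
        by (intro mult_right_mono) auto
      finally show "integral\<^sup>L M (Y n k) powr (1 / p) \<le> \<bar>C\<bar> * h n powr (l * \<beta>)" .
    qed (use p in auto)
    also have "\<dots> = \<bar>C\<bar> powr p * h n powr (q * \<beta>)"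
      using l by (simp add: powr_mult powr_powr p_def mult.commute)
    finally show ?thesis .
  qed
  define f where "f n \<omega> = (\<Sum>k<2 ^ n. Y n k \<omega> * h n powr (- (q * \<gamma>)))" for n \<omega>
  have f_nn: "f n \<omega> \<ge> 0" for n \<omega>
    by (auto simp: f_def Y_def intro!: sum_nonneg)
  have int_f: "integrable M (f n)" for n
    unfolding f_def[abs_def] by (intro Bochner_Integration.integrable_sum integrable_mult_left int_Y) auto
  \<comment> \<open>\<open>e\<close> is the power of \<open>h\<close> left after paying for the
    number of cells; halving the mesh multiplies \<open>h powr e\<close> by
    \<open>r < 1\<close>.\<close>
  define e where "e = (\<beta> - \<gamma>) * q - 1"
  define r where "r = 2 powr - e"
  have "2 powr - e < 2 powr (0::real)"
    using gap by (intro powr_less_mono) (auto simp: e_def)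
  then have r: "0 < r" "r < 1" by (auto simp: r_def)
  define D where "D = \<bar>C\<bar> powr p * T * T powr e"
  have D: "D \<ge> 0" using T by (simp add: D_def)
  have int_f_le: "integral\<^sup>L M (f n) \<le> D * r ^ n" for n
  proof -
    have "integral\<^sup>L M (f n) = (\<Sum>k<2 ^ n. integral\<^sup>L M (Y n k) * h n powr (- (q * \<gamma>)))"
      unfolding f_def[abs_def] using int_Y by (subst Bochner_Integration.integral_sum) auto
    also have "\<dots> \<le> (\<Sum>k<(2::nat) ^ n. \<bar>C\<bar> powr p * h n powr (q * \<beta>) * h n powr (- (q * \<gamma>)))"
      by (intro sum_mono mult_right_mono mom) auto
    also have "\<dots> = 2 ^ n * (\<bar>C\<bar> powr p * (h n powr (q * \<beta>) * h n powr (- (q * \<gamma>))))"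
      by simp
    also have "h n powr (q * \<beta>) * h n powr (- (q * \<gamma>)) = h n powr (1 + e)"
      by (simp add: e_def algebra_simps flip: powr_add)
    also have "\<dots> = h n * h n powr e"
      using h[of n] by (simp add: powr_add)
    also have "h n powr e = T powr e * r ^ n"
    proof -
      have "h n = T * 2 powr (- real n)"
        by (simp add: h_def powr_minus powr_realpow divide_inverse)
      then have "h n powr e = T powr e * 2 powr (- e * real n)"
        using T by (simp add: powr_mult powr_powr mult.commute)
      also have "2 powr (- e * real n) = r ^ n"
        by (simp add: r_def powr_powr flip: powr_realpow)
      finally show ?thesis .
    qed
    also have "2 ^ n * (\<bar>C\<bar> powr p * (h n * (T powr e * r ^ n))) = D * r ^ n"
      by (simp add: h_def D_def)
    finally show ?thesis .
  qed
  \<comment> \<open>The series is summed in \<open>ennreal\<close>, where expectation and sum can be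
    exchanged before finiteness is known.\<close>
  define S where "S \<omega> = (\<Sum>n. ennreal (f n \<omega>))" for \<omega>
  have meas_f [measurable]: "f n \<in> borel_measurable M" for n
    using int_f by auto
  have meas_S [measurable]: "S \<in> borel_measurable M"
    unfolding S_def[abs_def] by measurable
  have geometric_fin: "(\<Sum>n. ennreal (D * r ^ n)) \<noteq> top"
    by (rule ennreal_suminf_neq_top) (use r D in \<open>auto intro!: summable_mult summable_geometric\<close>)
  have "(\<integral>\<^sup>+ \<omega>. S \<omega> \<partial>M) = (\<Sum>n. \<integral>\<^sup>+ \<omega>. ennreal (f n \<omega>) \<partial>M)"
    unfolding S_def by (rule nn_integral_suminf) simp
  also have "\<dots> = (\<Sum>n. ennreal (integral\<^sup>L M (f n)))"
    by (intro suminf_cong nn_integral_eq_integral int_f) (simp add: f_nn)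
  also have "\<dots> \<le> (\<Sum>n. ennreal (D * r ^ n))"
    by (intro suminf_le) (auto intro: ennreal_leI int_f_le)
  also have "\<dots> < \<infinity>"
    using geometric_fin by (simp add: less_top)
  finally have S_fin: "(\<integral>\<^sup>+ \<omega>. S \<omega> \<partial>M) < \<infinity>" .
  \<comment> \<open>\<open>enn2real\<close> sends infinity to 0, which makes \<open>H\<close> real
    everywhere; the set where \<open>S\<close> is infinite is null by \<open>AE_S\<close>.\<close>
  define H where "H \<omega> = enn2real (S \<omega>)" for \<omega>
  have AE_S: "AE \<omega> in M. S \<omega> \<noteq> \<infinity>"
    using S_fin by (intro nn_integral_PInf_AE) auto
  show thesis
  proof (rule that[of H])
    have "(\<integral>\<^sup>+ \<omega>. ennreal (H \<omega>) \<partial>M) \<le> (\<integral>\<^sup>+ \<omega>. S \<omega> \<partial>M)"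
      unfolding H_def by (intro nn_integral_mono) (simp add: ennreal_enn2real_if)
    then have "(\<integral>\<^sup>+ \<omega>. ennreal (H \<omega>) \<partial>M) < \<infinity>"
      using S_fin by (rule le_less_trans)
    moreover have "H \<in> borel_measurable M"
      unfolding H_def[abs_def] by measurable
    ultimately show "integrable M H"
      by (intro integrableI_nonneg) (auto simp: H_def)
    show "H \<omega> \<ge> 0" for \<omega>
      by (simp add: H_def)
    show "AE \<omega> in M. \<forall>n. \<forall>k<2 ^ n. norm (Z n k \<omega>) \<le> H \<omega> powr (l / q) * (T / 2 ^ n) powr (l * \<gamma>)"
      using AE_S
    proof eventually_elim
      fix \<omega> assume fin: "S \<omega> \<noteq> \<infinity>"
      show "\<forall>n. \<forall>k<2 ^ n. norm (Z n k \<omega>) \<le> H \<omega> powr (l / q) * (T / 2 ^ n) powr (l * \<gamma>)"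
      proof (intro allI impI)
        fix n k :: nat assume k: "k < 2 ^ n"
        have "ennreal (f n \<omega>) \<le> S \<omega>"
          unfolding S_def using sum_le_suminf[of "\<lambda>n. ennreal (f n \<omega>)" "{n}"] by simp
        also have "S \<omega> = ennreal (H \<omega>)"
          using fin by (simp add: H_def ennreal_enn2real_if)
        finally have "f n \<omega> \<le> H \<omega>"
          by (simp add: H_def)
        moreover have "Y n k \<omega> * h n powr (- (q * \<gamma>)) \<le> f n \<omega>"
          unfolding f_def using k by (intro member_le_sum) (auto simp: Y_def)
        ultimately have "Y n k \<omega> * h n powr (- (q * \<gamma>)) \<le> H \<omega>" by simp
        then have "Y n k \<omega> \<le> H \<omega> * h n powr (q * \<gamma>)"
          using h[of n] by (simp add: powr_minus field_simps)
        \<comment> \<open>The root of order \<open>p\<close> recovers the norm;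
          \<open>1 / p = l / q\<close> produces the stated powers of \<open>H\<close> and
          \<open>h\<close>.\<close>
        then have "Y n k \<omega> powr (1 / p) \<le> (H \<omega> * h n powr (q * \<gamma>)) powr (1 / p)"
          using p by (intro powr_mono2) (auto simp: Y_def)
        also have "\<dots> = H \<omega> powr (l / q) * h n powr (l * \<gamma>)"
          using l q by (simp add: powr_mult powr_powr p_def mult.commute)
        finally show "norm (Z n k \<omega>) \<le> H \<omega> powr (l / q) * (T / 2 ^ n) powr (l * \<gamma>)"
          using p by (simp add: Y_def powr_powr h_def)
      qed
    qed
  qed
qed

lemma powr_in_Lq_space:
  fixes H :: "'\<omega> \<Rightarrow> real"
  assumes H: "integrable M H" "\<And>\<omega>. H \<omega> \<ge> 0" and r: "r > 0"
  shows "(\<lambda>\<omega>. c * H \<omega> powr (1 / r)) \<in> Lq_space M r"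
proof -
  have [measurable]: "H \<in> borel_measurable M" using H(1) by auto
  have "norm (c * H \<omega> powr (1 / r)) powr r = \<bar>c\<bar> powr r * H \<omega>" for \<omega>
    using H(2)[of \<omega>] r by (simp add: abs_mult powr_mult powr_powr)
  then show ?thesis
    using H(1) by (simp add: Lq_space_def)
qed

section \<open>Auxiliary facts on grid cells, null sets and exponents\<close>

lemma modification_refl: "(\<And>i. i \<in> I \<Longrightarrow> X i \<in> borel_measurable M) \<Longrightarrow> modification M I X X"
  by (simp add: modification_def)

lemma dyadic_cell:
  assumes "T > 0" "k < 2 ^ n"
  shows "(real k * (T / 2 ^ n), real (Suc k) * (T / 2 ^ n)) \<in> time_simplex T"
    "\<bar>real (Suc k) * (T / 2 ^ n) - real k * (T / 2 ^ n)\<bar> = T / 2 ^ n"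
proof -
  have "real (Suc k) * (T / 2 ^ n) \<le> T"
    using dyadic_bounds(2)[OF assms(1) dyadic_grid_point[of "Suc k" n T]] assms(2) by simp
  then show "(real k * (T / 2 ^ n), real (Suc k) * (T / 2 ^ n)) \<in> time_simplex T"
    using assms(1) by (auto simp: time_simplex_def algebra_simps divide_strict_right_mono add_pos_nonneg)
  show "\<bar>real (Suc k) * (T / 2 ^ n) - real k * (T / 2 ^ n)\<bar> = T / 2 ^ n"
    using assms(1) by (simp add: left_diff_distrib[symmetric] del: times_divide_eq_right)
qed

text \<open>Chen's relation holds outside a null set that depends on the triple; for the countably
  many dyadic triples one null set serves them all.\<close>

lemma AE_dyadic_triples:
  assumes "\<And>s u t. 0 \<le> s \<Longrightarrow> s < u \<Longrightarrow> u < t \<Longrightarrow> t \<le> T \<Longrightarrow> AE \<omega> in M. P s u t \<omega>" and T: "T > 0"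
  shows "AE \<omega> in M. \<forall>s\<in>dyadic T. \<forall>u\<in>dyadic T. \<forall>t\<in>dyadic T. s < u \<longrightarrow> u < t \<longrightarrow> P s u t \<omega>"
  by (intro AE_ball_countable' countable_dyadic AE_impI assms(1)) (auto dest: dyadic_bounds[OF T])

text \<open>Chaining runs at an exponent above the desired one; on a bounded time interval the
  difference costs only a power of \<open>T\<close>.\<close>

lemma powr_decrease_exponent:
  fixes r T a b :: real
  assumes "0 < r" "r \<le> T" "a \<le> b"
  shows "r powr b \<le> T powr (b - a) * r powr a"
proof -
  have "r powr b = r powr (b - a) * r powr a"
    by (simp flip: powr_add)
  also have "\<dots> \<le> T powr (b - a) * r powr a"
    using assms by (intro mult_right_mono powr_mono2) auto
  finally show ?thesis .
qed

lemma cadlag_on_rightD: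
  "cadlag_on I f \<Longrightarrow> t \<in> I \<Longrightarrow> (f \<longlongrightarrow> f t) (at t within I \<inter> {t<..})"
  by (simp add: cadlag_on_def)

lemma cadlag_increments_right:
  fixes f :: "real \<Rightarrow> 'a::real_normed_vector"
  assumes f: "cadlag_on {0..T} f" and st: "0 \<le> s" "s < t" "t \<le> T"
  shows "((\<lambda>t. f t - f s) \<longlongrightarrow> f t - f s) (at t within {s<..T} \<inter> {t<..})"
    and "((\<lambda>s. f t - f s) \<longlongrightarrow> f t - f s) (at s within {0..<t} \<inter> {s<..})"
proof -
  have "(f \<longlongrightarrow> f t) (at t within {s<..T} \<inter> {t<..})"
    using st by (intro tendsto_within_subset[OF cadlag_on_rightD[OF f]]) auto
  then show "((\<lambda>t. f t - f s) \<longlongrightarrow> f t - f s) (at t within {s<..T} \<inter> {t<..})"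
    by (intro tendsto_intros)
  have "(f \<longlongrightarrow> f s) (at s within {0..<t} \<inter> {s<..})"
    using st by (intro tendsto_within_subset[OF cadlag_on_rightD[OF f]]) auto
  then show "((\<lambda>s. f t - f s) \<longlongrightarrow> f t - f s) (at s within {0..<t} \<inter> {s<..})"
    by (intro tendsto_intros)
qed

lemma simplex_moment_bound:
  fixes F :: "real \<Rightarrow> real \<Rightarrow> '\<omega> \<Rightarrow> 'a::{banach, second_countable_topology}"
  assumes T: "T > 0" and q: "q > 0" and l: "l > 0" and gap: "(\<beta> - \<gamma>) * q > 1"
    and F: "\<And>s t. (s, t) \<in> time_simplex T \<Longrightarrow> F s t \<in> Lq_space M (q / l)"
    and norm_F: "\<And>s t. (s, t) \<in> time_simplex T \<Longrightarrow>
      Lq_norm M (q / l) (F s t) \<le> C * \<bar>t - s\<bar> powr (l * \<beta>)"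
  obtains H where "integrable M H" "\<And>\<omega>. H \<omega> \<ge> 0"
    "AE \<omega> in M. \<forall>n. \<forall>k<2 ^ n. norm (F (real k * (T / 2 ^ n)) (real (Suc k) * (T / 2 ^ n)) \<omega>)
      \<le> H \<omega> powr (l / q) * (T / 2 ^ n) powr (l * \<gamma>)"
proof (rule dyadic_moment_bound[OF T q l gap,
      where Z = "\<lambda>n k. F (real k * (T / 2 ^ n)) (real (Suc k) * (T / 2 ^ n))" and M = M and C = C])
  fix n k :: nat assume k: "k < 2 ^ n"
  show "F (real k * (T / 2 ^ n)) (real (Suc k) * (T / 2 ^ n)) \<in> Lq_space M (q / l)"
    by (rule F[OF dyadic_cell(1)[OF T k]])
  show "Lq_norm M (q / l) (F (real k * (T / 2 ^ n)) (real (Suc k) * (T / 2 ^ n)))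
      \<le> C * (T / 2 ^ n) powr (l * \<beta>)"
    using norm_F[OF dyadic_cell(1)[OF T k]] unfolding dyadic_cell(2)[OF T k] .
qed (rule that)

subsection \<open>The Kolmogorov criterion\<close>

theorem theoremA1:
  fixes M :: "'\<omega> measure"
    and T q \<beta> :: real
    and tens1 :: "'v11::{banach, second_countable_topology} \<Rightarrow> 'v12::{banach, second_countable_topology}
                  \<Rightarrow> 'w::{banach, second_countable_topology}"
    and tens :: "'w \<Rightarrow> 'v2::{banach, second_countable_topology}
                  \<Rightarrow> 'z::{banach, second_countable_topology}"
    and A :: "real \<Rightarrow> real \<Rightarrow> '\<omega> \<Rightarrow> 'z"
    and A1 :: "real \<Rightarrow> real \<Rightarrow> '\<omega> \<Rightarrow> 'w"
    and A11 :: "real \<Rightarrow> '\<omega> \<Rightarrow> 'v11"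
    and A12 :: "real \<Rightarrow> '\<omega> \<Rightarrow> 'v12"
    and A2 :: "real \<Rightarrow> '\<omega> \<Rightarrow> 'v2"
  assumes "prob_space M" and "T > 0"
    and "finite_dim (UNIV :: 'v11 set)"
    and "finite_dim (UNIV :: 'v12 set)"
    and "finite_dim (UNIV :: 'v2 set)"
    and "tensor_product tens1" and "tensor_product tens"
    and "cadlag_process2 M T A" and "cadlag_process2 M T A1"
    and "cadlag_process M T A2" and "cadlag_process M T A11" and "cadlag_process M T A12"
    and "\<And>s u t. 0 \<le> s \<Longrightarrow> s < u \<Longrightarrow> u < t \<Longrightarrow> t \<le> T \<Longrightarrow>
           AE \<omega> in M. incr2 A s u t \<omega> = tens (A1 s u \<omega>) (incr A2 u t \<omega>)"
    and "\<And>s u t. 0 \<le> s \<Longrightarrow> s < u \<Longrightarrow> u < t \<Longrightarrow> t \<le> T \<Longrightarrow>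
           AE \<omega> in M. incr2 A1 s u t \<omega> = tens1 (incr A11 s u \<omega>) (incr A12 u t \<omega>)"
    and "q \<ge> 3" and "\<beta> > 1 / q"
    and "\<exists>C. \<forall>(s, t)\<in>time_simplex T.
           incr A11 s t \<in> Lq_space M q \<and> incr A12 s t \<in> Lq_space M q \<and> incr A2 s t \<in> Lq_space M q \<and>
           max (Lq_norm M q (incr A11 s t)) (max (Lq_norm M q (incr A12 s t)) (Lq_norm M q (incr A2 s t)))
             \<le> C * \<bar>t - s\<bar> powr \<beta>"
    and "\<exists>C. \<forall>(s, t)\<in>time_simplex T.
           A1 s t \<in> Lq_space M (q / 2) \<and> Lq_norm M (q / 2) (A1 s t) \<le> C * \<bar>t - s\<bar> powr (2 * \<beta>)"
    and "\<exists>C. \<forall>(s, t)\<in>time_simplex T.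
           A s t \<in> Lq_space M (q / 3) \<and> Lq_norm M (q / 3) (A s t) \<le> C * \<bar>t - s\<bar> powr (3 * \<beta>)"
  shows "\<forall>\<alpha>. 0 \<le> \<alpha> \<and> \<alpha> < \<beta> - 1 / q \<longrightarrow>
    (\<exists>A' A1' A11' A12' A2'. \<exists>K1 \<in> Lq_space M q. \<exists>K2 \<in> Lq_space M (q / 2). \<exists>K3 \<in> Lq_space M (q / 3).
       modification M (time_simplex T) (case_prod A) (case_prod A') \<and>
       modification M (time_simplex T) (case_prod A1) (case_prod A1') \<and>
       modification M {0..T} A11 A11' \<and>
       modification M {0..T} A12 A12' \<and>
       modification M {0..T} A2 A2' \<and>
       (AE \<omega> in M. \<forall>(s, t)\<in>time_simplex T.
          norm (A' s t \<omega>) \<le> K3 \<omega> * \<bar>t - s\<bar> powr (3 * \<alpha>) \<and>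
          norm (A1' s t \<omega>) \<le> K2 \<omega> * \<bar>t - s\<bar> powr (2 * \<alpha>) \<and>
          max (norm (incr A2' s t \<omega>)) (max (norm (incr A11' s t \<omega>)) (norm (incr A12' s t \<omega>)))
            \<le> K1 \<omega> * \<bar>t - s\<bar> powr \<alpha>))"
proof (intro allI impI, elim conjE)
  fix \<alpha> :: real assume \<alpha>: "0 \<le> \<alpha>" "\<alpha> < \<beta> - 1 / q"
  note T = assms(2) and cadlag = assms(8-12) and Chen = assms(13) and Chen1 = assms(14)
  have q: "q > 0" using assms(15) by simp
  \<comment> \<open>The midpoint lies strictly below \<open>\<beta> - 1 / q\<close>, which gives
    \<open>gap\<close>, and is positive even when \<open>\<alpha> = 0\<close>.\<close>
  define \<gamma> where "\<gamma> = (\<alpha> + (\<beta> - 1 / q)) / 2"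
  have \<gamma>: "0 < \<gamma>" "\<alpha> \<le> \<gamma>"
    using \<alpha> by (auto simp: \<gamma>_def)
  have "1 / q < \<beta> - \<gamma>"
    using \<alpha> by (simp add: \<gamma>_def field_simps)
  then have gap: "(\<beta> - \<gamma>) * q > 1"
    using q by (simp add: field_simps)

  \<comment> \<open>Moment bounds on the grid and one common random variable\<close>
  obtain C1 where C1: "\<And>s t. (s, t) \<in> time_simplex T \<Longrightarrow>
      incr A11 s t \<in> Lq_space M q \<and> incr A12 s t \<in> Lq_space M q \<and> incr A2 s t \<in> Lq_space M q \<and>
      Lq_norm M q (incr A11 s t) \<le> C1 * \<bar>t - s\<bar> powr \<beta> \<and>
      Lq_norm M q (incr A12 s t) \<le> C1 * \<bar>t - s\<bar> powr \<beta> \<and>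
      Lq_norm M q (incr A2 s t) \<le> C1 * \<bar>t - s\<bar> powr \<beta>"
    using assms(17) by fastforce
  obtain C2 where C2: "\<And>s t. (s, t) \<in> time_simplex T \<Longrightarrow>
      A1 s t \<in> Lq_space M (q / 2) \<and> Lq_norm M (q / 2) (A1 s t) \<le> C2 * \<bar>t - s\<bar> powr (2 * \<beta>)"
    using assms(18) by fastforce
  obtain C3 where C3: "\<And>s t. (s, t) \<in> time_simplex T \<Longrightarrow>
      A s t \<in> Lq_space M (q / 3) \<and> Lq_norm M (q / 3) (A s t) \<le> C3 * \<bar>t - s\<bar> powr (3 * \<beta>)"
    using assms(19) by fastforce

  \<comment> \<open>The parameter \<open>l\<close> is the level of the process. Each instance
    returns an integrable variable, whatever \<open>l\<close> is, so that the five can be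
    added.\<close>
  obtain H11 where H11: "integrable M H11" "\<And>\<omega>. H11 \<omega> \<ge> 0"
    "AE \<omega> in M. \<forall>n. \<forall>k<2 ^ n. norm (incr A11 (real k * (T / 2 ^ n)) (real (Suc k) * (T / 2 ^ n)) \<omega>)
      \<le> H11 \<omega> powr (1 / q) * (T / 2 ^ n) powr \<gamma>"
    by (rule simplex_moment_bound[where M = M and F = "incr A11" and l = 1 and C = C1, OF T q _ gap])
       (use C1 in \<open>simp_all del: of_nat_Suc\<close>)
  obtain H12 where H12: "integrable M H12" "\<And>\<omega>. H12 \<omega> \<ge> 0"
    "AE \<omega> in M. \<forall>n. \<forall>k<2 ^ n. norm (incr A12 (real k * (T / 2 ^ n)) (real (Suc k) * (T / 2 ^ n)) \<omega>)
      \<le> H12 \<omega> powr (1 / q) * (T / 2 ^ n) powr \<gamma>"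
    by (rule simplex_moment_bound[where M = M and F = "incr A12" and l = 1 and C = C1, OF T q _ gap])
       (use C1 in \<open>simp_all del: of_nat_Suc\<close>)
  obtain H2 where H2: "integrable M H2" "\<And>\<omega>. H2 \<omega> \<ge> 0"
    "AE \<omega> in M. \<forall>n. \<forall>k<2 ^ n. norm (incr A2 (real k * (T / 2 ^ n)) (real (Suc k) * (T / 2 ^ n)) \<omega>)
      \<le> H2 \<omega> powr (1 / q) * (T / 2 ^ n) powr \<gamma>"
    by (rule simplex_moment_bound[where M = M and F = "incr A2" and l = 1 and C = C1, OF T q _ gap])
       (use C1 in \<open>simp_all del: of_nat_Suc\<close>)
  obtain HA1 where HA1: "integrable M HA1" "\<And>\<omega>. HA1 \<omega> \<ge> 0"
    "AE \<omega> in M. \<forall>n. \<forall>k<2 ^ n. norm (A1 (real k * (T / 2 ^ n)) (real (Suc k) * (T / 2 ^ n)) \<omega>)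
      \<le> HA1 \<omega> powr (2 / q) * (T / 2 ^ n) powr (2 * \<gamma>)"
    by (rule simplex_moment_bound[where M = M and F = "A1" and l = 2 and C = C2, OF T q _ gap])
       (use C2 in \<open>simp_all del: of_nat_Suc\<close>)
  obtain HA where HA: "integrable M HA" "\<And>\<omega>. HA \<omega> \<ge> 0"
    "AE \<omega> in M. \<forall>n. \<forall>k<2 ^ n. norm (A (real k * (T / 2 ^ n)) (real (Suc k) * (T / 2 ^ n)) \<omega>)
      \<le> HA \<omega> powr (3 / q) * (T / 2 ^ n) powr (3 * \<gamma>)"
    by (rule simplex_moment_bound[where M = M and F = "A" and l = 3 and C = C3, OF T q _ gap])
       (use C3 in \<open>simp_all del: of_nat_Suc\<close>)

  define H where "H \<omega> = H11 \<omega> + H12 \<omega> + H2 \<omega> + HA1 \<omega> + HA \<omega>" for \<omega>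
  note H_nn = H11(2) H12(2) H2(2) HA1(2) HA(2)
  have H: "integrable M H" "\<And>\<omega>. H \<omega> \<ge> 0"
    using H_nn H11(1) H12(1) H2(1) HA1(1) HA(1) by (auto simp: H_def[abs_def])
  have H_ge: "H11 \<omega> \<le> H \<omega>" "H12 \<omega> \<le> H \<omega>" "H2 \<omega> \<le> H \<omega>" "HA1 \<omega> \<le> H \<omega>" "HA \<omega> \<le> H \<omega>" for \<omega>
    using H_nn[of \<omega>] unfolding H_def by linarith+
  define R where "R \<omega> = H \<omega> powr (1 / q)" for \<omega>
  have R_pow: "R \<omega> \<ge> 0" "(R \<omega>)\<^sup>2 = H \<omega> powr (2 / q)" "(R \<omega>) ^ 3 = H \<omega> powr (3 / q)" for \<omega>
    using H(2)[of \<omega>] by (simp_all add: R_def power2_eq_square power3_eq_cube flip: powr_add)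
  have weaken: "x \<le> H \<omega> powr a * y" if "x \<le> G powr a * y" "0 \<le> G" "G \<le> H \<omega>" "0 \<le> a" "0 \<le> y" for x y a G \<omega>
    using that by (meson mult_right_mono order_trans powr_mono2)

  \<comment> \<open>Deterministic constants and the random variables \<open>K1\<close>,
    \<open>K2\<close>, \<open>K3\<close>\<close>
  have fin: "finite_dim (UNIV :: 'w set)"
    by (rule finite_dim_tensor_product) (rule assms)+
  obtain L1 where L1: "L1 \<ge> 0" "\<And>x y. norm (tens1 x y) \<le> L1 * norm x * norm y"
    by (rule bilinear_bounded_finite_dim[of tens1]) (use assms(3,4,6) in \<open>auto simp: tensor_product_def\<close>)
  obtain L where L: "L \<ge> 0" "\<And>x y. norm (tens x y) \<le> L * norm x * norm y"
    by (rule bilinear_bounded_finite_dim[of tens]) (use fin assms(5,7) in \<open>auto simp: tensor_product_def\<close>)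

  \<comment> \<open>The same expressions as in \<open>dyadic_rough_bounds\<close>, so that its
    conclusions can be folded to these names.\<close>
  define c1 where "c1 = chain_const \<gamma>"
  define c2 where "c2 = chain_const (2 * \<gamma>) * (1 + L1 * c1\<^sup>2)"
  define c3 where "c3 = chain_const (3 * \<gamma>) * (1 + L * c2 * c1)"
  have c: "c1 \<ge> 0" "c2 \<ge> 0" "c3 \<ge> 0"
    using \<gamma>(1) L1(1) L(1) chain_const_nonneg by (auto simp: c1_def c2_def c3_def)
  \<comment> \<open>The powers of \<open>T\<close> pay for lowering \<open>l * \<gamma>\<close> to
    \<open>l * \<alpha>\<close>. The exponents of \<open>H\<close> are reciprocal to the
    integrability exponents, so the power tested by \<open>Lq_space\<close> is a multiple of
    \<open>H\<close>.\<close>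
  define K1 where "K1 \<omega> = c1 * T powr (\<gamma> - \<alpha>) * H \<omega> powr (1 / q)" for \<omega>
  define K2 where "K2 \<omega> = c2 * T powr (2 * \<gamma> - 2 * \<alpha>) * H \<omega> powr (1 / (q / 2))" for \<omega>
  define K3 where "K3 \<omega> = c3 * T powr (3 * \<gamma> - 3 * \<alpha>) * H \<omega> powr (1 / (q / 3))" for \<omega>
  have K: "K1 \<in> Lq_space M q" "K2 \<in> Lq_space M (q / 2)" "K3 \<in> Lq_space M (q / 3)"
    using q unfolding K1_def[abs_def] K2_def[abs_def] K3_def[abs_def]
    by (auto intro!: powr_in_Lq_space[OF H] simp del: divide_divide_eq_right)

  \<comment> \<open>Pathwise bounds outside one null set\<close>
  have AE_Chen: "AE \<omega> in M. \<forall>s\<in>dyadic T. \<forall>u\<in>dyadic T. \<forall>t\<in>dyadic T. s < u \<longrightarrow> u < t \<longrightarrow>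
      incr2 A s u t \<omega> = tens (A1 s u \<omega>) (incr A2 u t \<omega>)"
    by (intro AE_dyadic_triples Chen T)
  have AE_Chen1: "AE \<omega> in M. \<forall>s\<in>dyadic T. \<forall>u\<in>dyadic T. \<forall>t\<in>dyadic T. s < u \<longrightarrow> u < t \<longrightarrow>
      incr2 A1 s u t \<omega> = tens1 (incr A11 s u \<omega>) (incr A12 u t \<omega>)"
    by (intro AE_dyadic_triples Chen1 T)
  \<comment> \<open>Finitely many almost sure statements are combined: regularity of the paths,
    Chen's relation on dyadic triples, and the cell bounds. Afterwards the argument is deterministic
    for each remaining \<open>\<omega>\<close>.\<close>
  have bounds: "AE \<omega> in M. \<forall>(s, t)\<in>time_simplex T.
      norm (A s t \<omega>) \<le> K3 \<omega> * \<bar>t - s\<bar> powr (3 * \<alpha>) \<and>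
      norm (A1 s t \<omega>) \<le> K2 \<omega> * \<bar>t - s\<bar> powr (2 * \<alpha>) \<and>
      max (norm (incr A2 s t \<omega>)) (max (norm (incr A11 s t \<omega>)) (norm (incr A12 s t \<omega>)))
        \<le> K1 \<omega> * \<bar>t - s\<bar> powr \<alpha>"
    using cadlag[unfolded cadlag_process_def cadlag_process2_def, THEN conjunct2]
      AE_Chen AE_Chen1
      H11(3) H12(3) H2(3) HA1(3) HA(3)
  proof eventually_elim
    case (elim \<omega>)
    note cadA = elim(1) and cadA1 = elim(2) and cad2 = elim(3) and cad11 = elim(4) and cad12 = elim(5)
    note Ch = elim(6) and Ch1 = elim(7)
    have e11: "norm (A11 (real (Suc k) * (T / 2 ^ n)) \<omega> - A11 (real k * (T / 2 ^ n)) \<omega>) \<le> R \<omega> * (T / 2 ^ n) powr \<gamma>"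
      if "k < 2 ^ n" for n k
      using elim(8) that H_nn H_ge q unfolding R_def by (intro weaken) (auto simp: incr_def)
    have e12: "norm (A12 (real (Suc k) * (T / 2 ^ n)) \<omega> - A12 (real k * (T / 2 ^ n)) \<omega>) \<le> R \<omega> * (T / 2 ^ n) powr \<gamma>"
      if "k < 2 ^ n" for n k
      using elim(9) that H_nn H_ge q unfolding R_def by (intro weaken) (auto simp: incr_def)
    have e2: "norm (A2 (real (Suc k) * (T / 2 ^ n)) \<omega> - A2 (real k * (T / 2 ^ n)) \<omega>) \<le> R \<omega> * (T / 2 ^ n) powr \<gamma>"
      if "k < 2 ^ n" for n k
      using elim(10) that H_nn H_ge q unfolding R_def by (intro weaken) (auto simp: incr_def)
    have eA1: "norm (A1 (real k * (T / 2 ^ n)) (real (Suc k) * (T / 2 ^ n)) \<omega>) \<le> (R \<omega>)\<^sup>2 * (T / 2 ^ n) powr (2 * \<gamma>)"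
      if "k < 2 ^ n" for n k
      using elim(11) that H_nn H_ge q unfolding R_pow by (intro weaken) auto
    have eA: "norm (A (real k * (T / 2 ^ n)) (real (Suc k) * (T / 2 ^ n)) \<omega>) \<le> R \<omega> ^ 3 * (T / 2 ^ n) powr (3 * \<gamma>)"
      if "k < 2 ^ n" for n k
      using elim(12) that H_nn H_ge q unfolding R_pow by (intro weaken) auto
    have Ch1': "A1 s t \<omega> - A1 s u \<omega> - A1 u t \<omega> = tens1 (A11 u \<omega> - A11 s \<omega>) (A12 t \<omega> - A12 u \<omega>)"
      if "s \<in> dyadic T" "u \<in> dyadic T" "t \<in> dyadic T" "s < u" "u < t" for s u t
      using Ch1 that by (simp add: incr_def incr2_def)
    have Ch': "A s t \<omega> - A s u \<omega> - A u t \<omega> = tens (A1 s u \<omega>) (A2 t \<omega> - A2 u \<omega>)"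
      if "s \<in> dyadic T" "u \<in> dyadic T" "t \<in> dyadic T" "s < u" "u < t" for s u t
      using Ch that by (simp add: incr_def incr2_def)
    note dy = dyadic_rough_bounds[OF T \<gamma>(1) R_pow(1) L1(1) L(1) L1(2) L(2) e11 e12 e2 eA1 eA Ch1' Ch',
        folded c1_def, folded c2_def, folded c3_def]
    show ?case
    proof (clarify, intro conjI max.boundedI)
      fix s t assume "(s, t) \<in> time_simplex T"
      then have st: "0 \<le> s" "s < t" "t \<le> T" by (auto simp: time_simplex_def)
      have lower: "norm x \<le> K * T powr (b - a) * G * \<bar>t - s\<bar> powr a"
        if "norm x \<le> K * G * (t - s) powr b" "0 \<le> K" "0 \<le> G" "a \<le> b"
        for x :: "'x::real_normed_vector" and K G a b
      proof -
        have "K * G * (t - s) powr b \<le> K * G * (T powr (b - a) * (t - s) powr a)"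
          using st that by (intro mult_left_mono powr_decrease_exponent) auto
        then show ?thesis using that(1) st by (simp add: mult_ac)
      qed
      have "norm (A s t \<omega>) \<le> c3 * R \<omega> ^ 3 * (t - s) powr (3 * \<gamma>)"
        by (rule extend_dyadic_bound[OF T, where F = "\<lambda>s t. A s t \<omega>"])
           (use dy(5) cadA st in \<open>auto intro!: cadlag_on_rightD\<close>)
      from lower[OF this, of "3 * \<alpha>"] show "norm (A s t \<omega>) \<le> K3 \<omega> * \<bar>t - s\<bar> powr (3 * \<alpha>)"
        using c R_pow(1)[of \<omega>] \<gamma> by (simp add: K3_def R_pow(3))
      have "norm (A1 s t \<omega>) \<le> c2 * (R \<omega>)\<^sup>2 * (t - s) powr (2 * \<gamma>)"
        by (rule extend_dyadic_bound[OF T, where F = "\<lambda>s t. A1 s t \<omega>"])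
           (use dy(4) cadA1 st in \<open>auto intro!: cadlag_on_rightD\<close>)
      from lower[OF this, of "2 * \<alpha>"] show "norm (A1 s t \<omega>) \<le> K2 \<omega> * \<bar>t - s\<bar> powr (2 * \<alpha>)"
        using c R_pow(1)[of \<omega>] \<gamma> by (simp add: K2_def R_pow(2))
      \<comment> \<open>Generic in the target space, since the three paths live in different
        spaces.\<close>
      have level1: "norm (incr X s t \<omega>) \<le> K1 \<omega> * \<bar>t - s\<bar> powr \<alpha>"
        if X: "cadlag_on {0..T} (\<lambda>t. X t \<omega>)"
          and d: "\<And>s t. s \<in> dyadic T \<Longrightarrow> t \<in> dyadic T \<Longrightarrow> s < t \<Longrightarrow>
            norm (X t \<omega> - X s \<omega>) \<le> c1 * R \<omega> * (t - s) powr \<gamma>"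
        for X :: "real \<Rightarrow> '\<omega> \<Rightarrow> 'x::{banach, second_countable_topology}"
      proof -
        have "norm (X t \<omega> - X s \<omega>) \<le> c1 * R \<omega> * (t - s) powr \<gamma>"
          by (rule extend_dyadic_bound[OF T, where F = "\<lambda>s t. X t \<omega> - X s \<omega>"])
             (use d cadlag_increments_right[OF X] st in auto)
        from lower[OF this, of \<alpha>] show ?thesis
          using c R_pow(1)[of \<omega>] \<gamma> by (simp add: K1_def R_def incr_def)
      qed
      show "norm (incr A2 s t \<omega>) \<le> K1 \<omega> * \<bar>t - s\<bar> powr \<alpha>"
        by (rule level1[of A2, OF cad2], rule dy(3))
      show "norm (incr A11 s t \<omega>) \<le> K1 \<omega> * \<bar>t - s\<bar> powr \<alpha>"
        by (rule level1[of A11, OF cad11], rule dy(1))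
      show "norm (incr A12 s t \<omega>) \<le> K1 \<omega> * \<bar>t - s\<bar> powr \<alpha>"
        by (rule level1[of A12, OF cad12], rule dy(2))
    qed
  qed

  \<comment> \<open>With the processes as their own modifications only measurability remains, which
    is part of the cadlag conditions.\<close>
  have mods: "modification M (time_simplex T) (case_prod A) (case_prod A)"
    "modification M (time_simplex T) (case_prod A1) (case_prod A1)"
    "modification M {0..T} A11 A11" "modification M {0..T} A12 A12" "modification M {0..T} A2 A2"
    using cadlag by (auto intro!: modification_refl simp: cadlag_process_def cadlag_process2_def)
  show "\<exists>A' A1' A11' A12' A2'. \<exists>K1 \<in> Lq_space M q. \<exists>K2 \<in> Lq_space M (q / 2). \<exists>K3 \<in> Lq_space M (q / 3).
       modification M (time_simplex T) (case_prod A) (case_prod A') \<and>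
       modification M (time_simplex T) (case_prod A1) (case_prod A1') \<and>
       modification M {0..T} A11 A11' \<and>
       modification M {0..T} A12 A12' \<and>
       modification M {0..T} A2 A2' \<and>
       (AE \<omega> in M. \<forall>(s, t)\<in>time_simplex T.
          norm (A' s t \<omega>) \<le> K3 \<omega> * \<bar>t - s\<bar> powr (3 * \<alpha>) \<and>
          norm (A1' s t \<omega>) \<le> K2 \<omega> * \<bar>t - s\<bar> powr (2 * \<alpha>) \<and>
          max (norm (incr A2' s t \<omega>)) (max (norm (incr A11' s t \<omega>)) (norm (incr A12' s t \<omega>)))
            \<le> K1 \<omega> * \<bar>t - s\<bar> powr \<alpha>)"
    by (intro exI bexI[OF _ K(1)] bexI[OF _ K(2)] bexI[OF _ K(3)] conjI) (rule mods bounds)+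
qed

end
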